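(* Fix an integer $k\ge 2$. There is a randomized algorithm which receives as input a read-once $k$-basic formula $\Phi$ (with full access to it), parameters $\epsilon>0$ and $\delta>0$, and oracle (query) access to an assignment $\sigma:X\to\{0,1\}$, and outputs a number $\eta\in[0,1]$ such that: with probability at least $1-\delta$, $\sigma$ is both $(\eta+\epsilon)$-close to $\mathrm{SAT}(\Phi)$ and $(\eta-\epsilon)$-far from $\mathrm{SAT}(\Phi)$; if $\sigma\in\mathrm{SAT}(\Phi)$ then $\eta=0$ with probability $1$; and, treating $k$ and $\delta$ as constants, its number of queries is always $O(\exp(\mathrm{poly}(\epsilon^{-1})))$.
   Context: A read-once Boolean formula $\Phi$ is a rooted directed tree whose leaves are labeled by variables from a set $X$ (or by constants $0,1$), each variable labeling at most one leaf, and whose every internal vertex is labeled by a Boolean function of arity equal to its number of children (children ordered). Given an assignment $\sigma:X\to\{0,1\}$ values are computed bottom-up and $\sigma(\Phi)$ is the value at the root. $\mathrm{SAT}(\Phi)$ is the set of assignments with $\sigma(\Phi)=1$. The distance between two assignments is the fraction of variables of $X$ on which they differ; $\sigma$ is $\epsilon$-far from a set $S$ of assignments if its distance from every member of $S$ is more than $\epsilon$, and $\epsilon$-close otherwise. Each query reveals $\sigma(x)$ for one variable $x$. For a Boolean function $f$, input coordinate $i$ is $(a,b)$-forceful if $f(y)=b$ for every input $y$ with $y_i=a$; a gate is unforceable if none of its coordinates is $(a,b)$-forceful for any $a,b\in\{0,1\}$. A read-once formula is $k$-$x$-basic if: it is Boolean; every leaf is labeled by a variable; every internal gate is either a negation whose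 child is a leaf, or $\wedge$ or $\vee$ of arity at least $2$, or an unforceable function of arity between $2$ and $k$; no $\wedge$ gate has a $\wedge$ child and no $\vee$ gate has a $\vee$ child; and every variable appears in at most one leaf. It is $k$-basic if moreover all its unforceable gates are monotone functions. *)

theory Defs
  imports "HOL-Probability.Probability" "HOL-Computational_Algebra.Polynomial"
begin

section \<open>Boolean formulas\<close>

text \<open>
  A Boolean function of arity n is represented by a function on lists of truth values of
  which only the values on lists of length n matter; the arity of a gate is its number of
  children. All notions below for such functions therefore carry the arity explicitly.
\<close>

datatype 'v formula =
    Var 'v
  | Const bool
  | Gate "bool list \<Rightarrow> bool" "'v formula list"

primrec value_of :: "('v \<Rightarrow> bool) \<Rightarrow> 'v formula \<Rightarrow> bool" where
  "value_of \<sigma> (Var x) = \<sigma> x"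
| "value_of \<sigma> (Const b) = b"
| "value_of \<sigma> (Gate f ts) = f (map (value_of \<sigma>) ts)"

primrec leaf_vars :: "'v formula \<Rightarrow> 'v list" where
  "leaf_vars (Var x) = [x]"
| "leaf_vars (Const b) = []"
| "leaf_vars (Gate f ts) = concat (map leaf_vars ts)"

primrec subformulas :: "'v formula \<Rightarrow> 'v formula set" where
  "subformulas (Var x) = {Var x}"
| "subformulas (Const b) = {Const b}"
| "subformulas (Gate f ts) = insert (Gate f ts) (\<Union> (set (map subformulas ts)))"

text \<open>
  The ambient finite variable set may contain variables that do not occur in the formula.
  Distinctness of the list of leaf variables says that each variable labels at most one leaf.
\<close>

definition read_once :: "'v set \<Rightarrow> 'v formula \<Rightarrow> bool" where
  "read_once X \<Phi> \<longleftrightarrow>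
     finite X \<and> set (leaf_vars \<Phi>) \<subseteq> X \<and> distinct (leaf_vars \<Phi>) \<and>
     (\<forall>f ts. Gate f ts \<in> subformulas \<Phi> \<longrightarrow> ts \<noteq> [])"

section \<open>Satisfying assignments and distance\<close>

definition assignments :: "'v set \<Rightarrow> ('v \<Rightarrow> bool) set" where
  "assignments X = X \<rightarrow>\<^sub>E UNIV"

definition SAT :: "'v set \<Rightarrow> 'v formula \<Rightarrow> ('v \<Rightarrow> bool) set" where
  "SAT X \<Phi> = {\<tau> \<in> assignments X. value_of \<tau> \<Phi>}"

definition distance :: "'v set \<Rightarrow> ('v \<Rightarrow> bool) \<Rightarrow> ('v \<Rightarrow> bool) \<Rightarrow> real" where
  "distance X \<sigma> \<tau> = real (card {x \<in> X. \<sigma> x \<noteq> \<tau> x}) / real (card X)"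

definition far_from :: "'v set \<Rightarrow> real \<Rightarrow> ('v \<Rightarrow> bool) \<Rightarrow> ('v \<Rightarrow> bool) set \<Rightarrow> bool" where
  "far_from X e \<sigma> S \<longleftrightarrow> (\<forall>\<tau>\<in>S. distance X \<sigma> \<tau> > e)"

definition close_to :: "'v set \<Rightarrow> real \<Rightarrow> ('v \<Rightarrow> bool) \<Rightarrow> ('v \<Rightarrow> bool) set \<Rightarrow> bool" where
  "close_to X e \<sigma> S \<longleftrightarrow> \<not> far_from X e \<sigma> S"

section \<open>Basic formulas\<close>

definition is_neg :: "nat \<Rightarrow> (bool list \<Rightarrow> bool) \<Rightarrow> bool" where
  "is_neg n f \<longleftrightarrow> n = 1 \<and> (\<forall>b. f [b] = (\<not> b))"

definition is_conj :: "nat \<Rightarrow> (bool list \<Rightarrow> bool) \<Rightarrow> bool" where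
  "is_conj n f \<longleftrightarrow> (\<forall>ys. length ys = n \<longrightarrow> f ys = (\<forall>i<n. ys ! i))"

definition is_disj :: "nat \<Rightarrow> (bool list \<Rightarrow> bool) \<Rightarrow> bool" where
  "is_disj n f \<longleftrightarrow> (\<forall>ys. length ys = n \<longrightarrow> f ys = (\<exists>i<n. ys ! i))"

definition forceful :: "nat \<Rightarrow> (bool list \<Rightarrow> bool) \<Rightarrow> nat \<Rightarrow> bool \<Rightarrow> bool \<Rightarrow> bool" where
  "forceful n f i a b \<longleftrightarrow> (\<forall>ys. length ys = n \<and> ys ! i = a \<longrightarrow> f ys = b)"

definition unforceable :: "nat \<Rightarrow> (bool list \<Rightarrow> bool) \<Rightarrow> bool" where
  "unforceable n f \<longleftrightarrow> (\<forall>i<n. \<forall>a b. \<not> forceful n f i a b)"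

definition monotone_gate :: "nat \<Rightarrow> (bool list \<Rightarrow> bool) \<Rightarrow> bool" where
  "monotone_gate n f \<longleftrightarrow>
     (\<forall>ys zs. length ys = n \<and> length zs = n \<and> list_all2 (\<le>) ys zs \<longrightarrow> f ys \<le> f zs)"

definition is_leaf :: "'v formula \<Rightarrow> bool" where
  "is_leaf t \<longleftrightarrow> (\<forall>f ts. t \<noteq> Gate f ts)"

definition kx_basic :: "nat \<Rightarrow> 'v set \<Rightarrow> 'v formula \<Rightarrow> bool" where
  "kx_basic k X \<Phi> \<longleftrightarrow>
     read_once X \<Phi> \<and>
     (\<forall>b. Const b \<notin> subformulas \<Phi>) \<and>
     (\<forall>f ts. Gate f ts \<in> subformulas \<Phi> \<longrightarrow>
        is_neg (length ts) f \<and> (\<forall>t\<in>set ts. is_leaf t) \<or>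
        2 \<le> length ts \<and> (is_conj (length ts) f \<or> is_disj (length ts) f) \<or>
        2 \<le> length ts \<and> length ts \<le> k \<and> unforceable (length ts) f) \<and>
     (\<forall>f ts g us. Gate f ts \<in> subformulas \<Phi> \<and> Gate g us \<in> set ts \<longrightarrow>
        \<not> (is_conj (length ts) f \<and> is_conj (length us) g) \<and>
        \<not> (is_disj (length ts) f \<and> is_disj (length us) g))"

definition k_basic :: "nat \<Rightarrow> 'v set \<Rightarrow> 'v formula \<Rightarrow> bool" where
  "k_basic k X \<Phi> \<longleftrightarrow>
     kx_basic k X \<Phi> \<and>
     (\<forall>f ts. Gate f ts \<in> subformulas \<Phi> \<and> unforceable (length ts) f \<longrightarrow>
        monotone_gate (length ts) f)"

section \<open>Query algorithms\<close>

text \<open>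
  A deterministic adaptive query algorithm is a decision tree: \<open>Query x T0 T1\<close> asks for
  the value of x and continues with T0 on answer 0 and with T1 on answer 1. A randomized
  query algorithm is a probability distribution over such trees. Repeated queries to the
  same variable are counted each time.
\<close>

datatype ('v, 'o) dtree =
    Output 'o
  | Query 'v "('v, 'o) dtree" "('v, 'o) dtree"

primrec run :: "('v, 'o) dtree \<Rightarrow> ('v \<Rightarrow> bool) \<Rightarrow> 'o" where
  "run (Output r) \<sigma> = r"
| "run (Query x T0 T1) \<sigma> = (if \<sigma> x then run T1 \<sigma> else run T0 \<sigma>)"

primrec queries :: "('v, 'o) dtree \<Rightarrow> ('v \<Rightarrow> bool) \<Rightarrow> 'v list" where
  "queries (Output r) \<sigma> = []"
| "queries (Query x T0 T1) \<sigma> = x # (if \<sigma> x then queries T1 \<sigma> else queries T0 \<sigma>)"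

end

theory Submission
  imports Defs
begin

text \<open>
  Negations occur only at leaves and all other gates are monotone, so the least number of flips
  that satisfies a gate is the minimum, over the sets of children whose truth makes the gate true,
  of the summed flip numbers of these children. Relative to the number of leaves, a conjunction
  averages the rates of its children with weights proportional to their sizes; a few sampled
  children estimate this average. At a disjunction of large arity the smallest child already
  shows that the rate is negligible. Every other gate has bounded arity, and no child is
  indispensable in it, so the sets of children that matter miss a noticeable fraction of the
  leaves; hence the children may be estimated with an accuracy that is coarser by a constant
  factor larger than 1. As no two conjunctions are adjacent, the required accuracy becomes trivial
  after polynomially many levels in the inverse accuracy, whatever the depth of the formula.
\<close>

section \<open>Sequential composition of decision trees\<close>

text \<open>Failure probabilities are merely added up, so \<open>l\<close> levels of recursion
  multiply both the queries and the failure probability by \<open>Q ^ l\<close>. This is affordable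
  for two reasons. Apart from the recursion, the only random step is the sampling at a conjunction;
  its failure probability \<beta> decreases exponentially in the sample size \<open>q\<close>,
  whereas \<open>Q\<close> is only proportional to \<open>q\<close>, so
  \<open>\<beta> * Q ^ l\<close> becomes small without repeating any estimator to boost its
  confidence. And \<open>l\<close> stays bounded because the accuracy grows geometrically, by a
  factor that is fixed in advance through a number \<open>a\<close> below all accuracies in the
  recursion.

  One-sidedness restricts the estimators: where a rate is known to be negligible, the constant to be
  output has to be 0, and the averages and minima that combine the children must turn exact zeros
  into an exact zero.\<close>

primrec bind_dtree :: "('v, 'a) dtree \<Rightarrow> ('a \<Rightarrow> ('v, 'b) dtree) \<Rightarrow> ('v, 'b) dtree" where
  "bind_dtree (Output r) g = g r"
| "bind_dtree (Query x T0 T1) g = Query x (bind_dtree T0 g) (bind_dtree T1 g)"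

lemma run_bind_dtree [simp]: "run (bind_dtree T g) \<sigma> = run (g (run T \<sigma>)) \<sigma>"
  by (induction T) auto

lemma queries_bind_dtree [simp]:
  "queries (bind_dtree T g) \<sigma> = queries T \<sigma> @ queries (g (run T \<sigma>)) \<sigma>"
  by (induction T) auto

primrec sequence_dtree :: "('v, 'a) dtree list \<Rightarrow> ('v, 'a list) dtree" where
  "sequence_dtree [] = Output []"
| "sequence_dtree (T # Ts) =
     bind_dtree T (\<lambda>r. bind_dtree (sequence_dtree Ts) (\<lambda>rs. Output (r # rs)))"

lemma run_sequence_dtree [simp]: "run (sequence_dtree Ts) \<sigma> = map (\<lambda>T. run T \<sigma>) Ts"
  by (induction Ts) auto

lemma queries_sequence_dtree [simp]:
  "queries (sequence_dtree Ts) \<sigma> = concat (map (\<lambda>T. queries T \<sigma>) Ts)"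
  by (induction Ts) auto


section \<open>Randomized estimators\<close>

text \<open>
  The estimated quantity depends on the queried assignment; the clause about value 0 is the
  one-sidedness of the algorithm.
\<close>

definition estimator ::
  "'v set \<Rightarrow> real \<Rightarrow> real \<Rightarrow> real \<Rightarrow> (('v \<Rightarrow> bool) \<Rightarrow> real) \<Rightarrow> ('v, real) dtree pmf \<Rightarrow> bool" where
  "estimator V W e b v p \<longleftrightarrow>
     (\<forall>\<sigma>. (\<forall>T\<in>set_pmf p. set (queries T \<sigma>) \<subseteq> V \<and> real (length (queries T \<sigma>)) \<le> W \<and>
            run T \<sigma> \<in> {0..1} \<and> (v \<sigma> = 0 \<longrightarrow> run T \<sigma> = 0)) \<and>
          measure_pmf.prob p {T. e < \<bar>run T \<sigma> - v \<sigma>\<bar>} \<le> b)"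

lemma estimator_mono:
  assumes "estimator V W e b v p" "V \<subseteq> V'" "W \<le> W'" "e \<le> e'" "b \<le> b'"
  shows "estimator V' W' e' b' v p"
  unfolding estimator_def
proof (intro allI conjI ballI)
  fix \<sigma>
  have "measure_pmf.prob p {T. e' < \<bar>run T \<sigma> - v \<sigma>\<bar>}
      \<le> measure_pmf.prob p {T. e < \<bar>run T \<sigma> - v \<sigma>\<bar>}"
    by (rule measure_pmf.finite_measure_mono) (use assms in auto)
  also have "\<dots> \<le> b'"
    using assms unfolding estimator_def by (meson order_trans)
  finally show "measure_pmf.prob p {T. e' < \<bar>run T \<sigma> - v \<sigma>\<bar>} \<le> b'" .
qed (use assms in \<open>unfold estimator_def, (blast intro: order_trans)+\<close>)

lemma estimator_return:
  assumes "\<And>\<sigma>. set (queries T \<sigma>) \<subseteq> V" "\<And>\<sigma>. real (length (queries T \<sigma>)) \<le> W"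
    "\<And>\<sigma>. run T \<sigma> \<in> {0..1}" "\<And>\<sigma>. v \<sigma> = 0 \<Longrightarrow> run T \<sigma> = 0"
    "\<And>\<sigma>. \<bar>run T \<sigma> - v \<sigma>\<bar> \<le> e" "b \<ge> 0"
  shows "estimator V W e b v (return_pmf T)"
  using assms(1-4,6) assms(5)[folded not_less]
  by (auto simp: estimator_def measure_return_pmf indicator_def)

text \<open>A union bound over \<open>m\<close> separately drawn estimators whose outputs are merged
  by \<open>G\<close>. The outputs reach \<open>G\<close> as a function on all natural numbers that
  is read off a list of length \<open>m\<close>; \<open>cong\<close> says that its values from
  \<open>m\<close> onwards do not matter.\<close>

lemma estimator_combine:
  fixes m :: nat and G :: "(nat \<Rightarrow> real) \<Rightarrow> real" and p :: "nat \<Rightarrow> ('v, real) dtree pmf"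
  assumes p: "\<And>j. j < m \<Longrightarrow> estimator V W e b (v j) (p j)"
    and range: "\<And>r. (\<And>j. j < m \<Longrightarrow> r j \<in> {0..1}) \<Longrightarrow> G r \<in> {0..1}"
    and zero: "\<And>\<sigma> r. u \<sigma> = 0 \<Longrightarrow> (\<And>j. j < m \<Longrightarrow> v j \<sigma> = 0 \<Longrightarrow> r j = 0) \<Longrightarrow>
                 (\<And>j. j < m \<Longrightarrow> r j \<in> {0..1}) \<Longrightarrow> G r = 0"
    and acc: "\<And>\<sigma> r. (\<And>j. j < m \<Longrightarrow> \<bar>r j - v j \<sigma>\<bar> \<le> e) \<Longrightarrow>
                (\<And>j. j < m \<Longrightarrow> r j \<in> {0..1}) \<Longrightarrow> \<bar>G r - u \<sigma>\<bar> \<le> e'"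
    and cong: "\<And>r r'. (\<And>j. j < m \<Longrightarrow> r j = r' j) \<Longrightarrow> G r = G r'"
  shows "\<exists>p'. estimator V (real m * W) e' (real m * b) u p'"
proof -
  define P where "P = Pi_pmf {..<m} undefined p"
  define tr where "tr = (\<lambda>Ts :: nat \<Rightarrow> ('v, real) dtree.
    bind_dtree (sequence_dtree (map Ts [0..<m])) (\<lambda>rs. Output (G (\<lambda>j. rs ! j))))"
  have run_tr: "run (tr Ts) \<sigma> = G (\<lambda>j. run (Ts j) \<sigma>)" for Ts \<sigma>
    unfolding tr_def by (auto intro: cong)
  have q_tr: "queries (tr Ts) \<sigma> = concat (map (\<lambda>j. queries (Ts j) \<sigma>) [0..<m])" for Ts \<sigma>
    unfolding tr_def by (simp add: comp_def)
  have comp: "Ts j \<in> set_pmf (p j)" if "Ts \<in> set_pmf P" "j < m" for Ts j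
    using that set_Pi_pmf[of "{..<m}" undefined p] unfolding P_def by (auto simp: PiE_dflt_def)
  have est: "set (queries T \<sigma>) \<subseteq> V" "real (length (queries T \<sigma>)) \<le> W"
      "run T \<sigma> \<in> {0..1}" "v j \<sigma> = 0 \<Longrightarrow> run T \<sigma> = 0" if "j < m" "T \<in> set_pmf (p j)" for T j \<sigma>
    using p[OF that(1)] that(2) unfolding estimator_def by blast+
  have bad: "measure_pmf.prob (p j) {T. e < \<bar>run T \<sigma> - v j \<sigma>\<bar>} \<le> b" if "j < m" for j \<sigma>
    using p[OF that] unfolding estimator_def by blast
  have "estimator V (real m * W) e' (real m * b) u (map_pmf tr P)"
    unfolding estimator_def
  proof (intro allI conjI ballI impI)
    fix \<sigma> T assume "T \<in> set_pmf (map_pmf tr P)"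
    then obtain Ts where Ts: "Ts \<in> set_pmf P" "T = tr Ts" by auto
    show "set (queries T \<sigma>) \<subseteq> V"
      using est(1)[OF _ comp[OF Ts(1)]] by (fastforce simp: Ts q_tr)
    have "real (length (queries T \<sigma>)) = (\<Sum>j\<in>{0..<m}. real (length (queries (Ts j) \<sigma>)))"
      by (simp add: Ts q_tr length_concat comp_def interv_sum_list_conv_sum_set_nat)
    also have "\<dots> \<le> (\<Sum>j\<in>{0..<m}. W)"
      by (rule sum_mono) (use est(2)[OF _ comp[OF Ts(1)]] in auto)
    finally show "real (length (queries T \<sigma>)) \<le> real m * W" by simp
    show "run T \<sigma> \<in> {0..1}"
      unfolding Ts run_tr by (rule range) (use est(3)[OF _ comp[OF Ts(1)]] in auto)
    show "run T \<sigma> = 0" if "u \<sigma> = 0"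
      unfolding Ts run_tr
      by (rule zero[OF that]) (use est(3,4)[OF _ comp[OF Ts(1)]] in auto)
  next
    fix \<sigma>
    let ?B = "\<lambda>j. {Ts. e < \<bar>run (Ts j) \<sigma> - v j \<sigma>\<bar>}"
    have "measure_pmf.prob (map_pmf tr P) {T. e' < \<bar>run T \<sigma> - u \<sigma>\<bar>}
        = measure_pmf.prob P {Ts. e' < \<bar>run (tr Ts) \<sigma> - u \<sigma>\<bar>}"
      by (simp add: vimage_def)
    also have "\<dots> \<le> measure_pmf.prob P (\<Union>j<m. ?B j)"
    \<comment> \<open>The inclusion is needed only on the support of \<open>P\<close>, where the
      estimates are known to lie in \<open>{0..1}\<close>, as \<open>acc\<close> may
      require.\<close>
    proof (rule measure_pmf.finite_measure_mono_AE)
      show "AE Ts in measure_pmf P. Ts \<in> {Ts. e' < \<bar>run (tr Ts) \<sigma> - u \<sigma>\<bar>} \<longrightarrow> Ts \<in> (\<Union>j<m. ?B j)"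
      proof (rule AE_pmfI, rule impI, rule ccontr)
        fix Ts assume Ts: "Ts \<in> set_pmf P" "Ts \<in> {Ts. e' < \<bar>run (tr Ts) \<sigma> - u \<sigma>\<bar>}"
          and "Ts \<notin> (\<Union>j<m. ?B j)"
        then have "\<bar>run (Ts j) \<sigma> - v j \<sigma>\<bar> \<le> e" if "j < m" for j
          using that by (auto simp: not_less)
        then have "\<bar>G (\<lambda>j. run (Ts j) \<sigma>) - u \<sigma>\<bar> \<le> e'"
          by (rule acc) (use est(3)[OF _ comp[OF Ts(1)]] in auto)
        then show False using Ts(2) by (simp add: run_tr)
      qed
    qed simp
    also have "\<dots> \<le> (\<Sum>j<m. measure_pmf.prob P (?B j))"
      by (rule measure_pmf.finite_measure_subadditive_finite) auto
    also have "\<dots> \<le> (\<Sum>j<m. b)"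
    proof (rule sum_mono)
      fix j assume j: "j \<in> {..<m}"
      have "measure_pmf.prob P (?B j)
          = measure_pmf.prob (map_pmf (\<lambda>f. f j) P) {T. e < \<bar>run T \<sigma> - v j \<sigma>\<bar>}"
        by (simp add: vimage_def)
      also have "map_pmf (\<lambda>f. f j) P = p j"
        using j by (simp add: P_def Pi_pmf_component)
      finally show "measure_pmf.prob P (?B j) \<le> b"
        using bad j by simp
    qed
    finally show "measure_pmf.prob (map_pmf tr P) {T. e' < \<bar>run T \<sigma> - u \<sigma>\<bar>} \<le> real m * b"
      by simp
  qed
  then show ?thesis ..
qed

text \<open>A bad outcome \<open>B\<close> of the first draw is paid for with probability 1 in the
  second, so the bound \<open>b\<close> is required only for the good outcomes.\<close>

lemma prob_bind_pmf_le:
  assumes "\<And>x. x \<in> set_pmf p \<Longrightarrow> x \<notin> B \<Longrightarrow> measure_pmf.prob (f x) S \<le> b" "b \<ge> 0"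
  shows "measure_pmf.prob (bind_pmf p f) S \<le> b + measure_pmf.prob p B"
proof -
  have "measure_pmf.prob (bind_pmf p f) S = measure_pmf.expectation p (\<lambda>x. measure_pmf.prob (f x) S)"
    unfolding measure_pmf_bind
    by (rule measure_pmf.measure_bind[where N = "count_space UNIV"])
       (auto simp: measurable_def space_subprob_algebra intro!: prob_space_imp_subprob_space prob_space_measure_pmf)
  also have "\<dots> \<le> measure_pmf.expectation p (\<lambda>x. b + indicator B x)"
  proof (rule integral_mono_AE)
    show "AE x in measure_pmf p. measure_pmf.prob (f x) S \<le> b + indicator B x"
      by (rule AE_pmfI) (use assms in \<open>auto simp: indicator_def intro: order_trans[OF measure_pmf.prob_le_1]\<close>)
  qed (auto intro!: measure_pmf.integrable_const_bound[where B = "1 + b"] AE_I2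
        order_trans[OF measure_pmf.prob_le_1] simp: indicator_def assms(2))
  also have "\<dots> = b + measure_pmf.prob p B"
    by (subst Bochner_Integration.integral_add)
       (auto intro!: measure_pmf.integrable_const_bound[where B = 1] simp: indicator_def)
  finally show ?thesis .
qed

text \<open>By the triangle inequality a large error needs an atypical \<open>x\<close> or a failure
  of the estimator for \<open>v x\<close>. One-sidedness holds with certainty, so
  \<open>zero\<close> is demanded for every possible \<open>x\<close> and not only for typical
  ones.\<close>

lemma estimator_mixture:
  assumes f: "\<And>x. x \<in> set_pmf p \<Longrightarrow> estimator V W e b (v x) (f x)"
    and zero: "\<And>x \<sigma>. x \<in> set_pmf p \<Longrightarrow> u \<sigma> = 0 \<Longrightarrow> v x \<sigma> = 0"
    and dev: "\<And>\<sigma>. measure_pmf.prob p {x. \<gamma> < \<bar>v x \<sigma> - u \<sigma>\<bar>} \<le> b'" and "b \<ge> 0"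
  shows "estimator V W (e + \<gamma>) (b + b') u (bind_pmf p f)"
  unfolding estimator_def
proof (intro allI conjI ballI impI)
  fix \<sigma> T assume "T \<in> set_pmf (bind_pmf p f)"
  then obtain x where x: "x \<in> set_pmf p" "T \<in> set_pmf (f x)" by auto
  have est: "set (queries T \<sigma>) \<subseteq> V" "real (length (queries T \<sigma>)) \<le> W"
      "run T \<sigma> \<in> {0..1}" "v x \<sigma> = 0 \<Longrightarrow> run T \<sigma> = 0"
    using f[OF x(1)] x(2) unfolding estimator_def by blast+
  show "set (queries T \<sigma>) \<subseteq> V" "real (length (queries T \<sigma>)) \<le> W" "run T \<sigma> \<in> {0..1}"
    using est(1-3) .
  show "run T \<sigma> = 0" if "u \<sigma> = 0"
    using est(4) zero[OF x(1) that] .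
next
  fix \<sigma>
  have "measure_pmf.prob (bind_pmf p f) {T. e + \<gamma> < \<bar>run T \<sigma> - u \<sigma>\<bar>}
     \<le> b + measure_pmf.prob p {x. \<gamma> < \<bar>v x \<sigma> - u \<sigma>\<bar>}"
  proof (rule prob_bind_pmf_le)
    fix x assume x: "x \<in> set_pmf p" "x \<notin> {x. \<gamma> < \<bar>v x \<sigma> - u \<sigma>\<bar>}"
    have "measure_pmf.prob (f x) {T. e + \<gamma> < \<bar>run T \<sigma> - u \<sigma>\<bar>}
        \<le> measure_pmf.prob (f x) {T. e < \<bar>run T \<sigma> - v x \<sigma>\<bar>}"
      by (rule measure_pmf.finite_measure_mono) (use x(2) in auto)
    also have "\<dots> \<le> b"
      using f[OF x(1)] unfolding estimator_def by blast
    finally show "measure_pmf.prob (f x) {T. e + \<gamma> < \<bar>run T \<sigma> - u \<sigma>\<bar>} \<le> b" .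
  qed fact
  also have "\<dots> \<le> b + b'" using dev by simp
  finally show "measure_pmf.prob (bind_pmf p f) {T. e + \<gamma> < \<bar>run T \<sigma> - u \<sigma>\<bar>} \<le> b + b'" .
qed

section \<open>Concentration of the mean of independent draws\<close>

lemma hoeffding_Pi_pmf:
  fixes g :: "'a \<Rightarrow> real"
  assumes g: "\<And>x. x \<in> set_pmf p \<Longrightarrow> g x \<in> {0..1}" and "q > 0" "\<gamma> \<ge> 0"
  shows "measure_pmf.prob (Pi_pmf {..<q} d (\<lambda>_. p))
           {xs. \<gamma> < \<bar>(\<Sum>i<q. g (xs i)) / real q - measure_pmf.expectation p g\<bar>}
         \<le> 2 * exp (- 2 * real q * \<gamma>\<^sup>2)"
proof -
  define P where "P = Pi_pmf {..<q} d (\<lambda>_. p)"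
  have marg: "map_pmf (\<lambda>f. f i) P = p" if "i < q" for i
    using that by (simp add: P_def Pi_pmf_component)
  have distr: "distr (measure_pmf P) borel (\<lambda>xs. g (xs i)) = distr (measure_pmf p) borel g"
    if "i < q" for i
  proof -
    have "distr (measure_pmf p) borel g
        = distr (distr (measure_pmf P) (count_space UNIV) (\<lambda>f. f i)) borel g"
      using marg[OF that] by (metis map_pmf_rep_eq)
    also have "\<dots> = distr (measure_pmf P) borel (\<lambda>xs. g (xs i))"
      by (subst distr_distr) (auto simp: comp_def)
    finally show ?thesis ..
  qed
  have "prob_space.indep_vars (measure_pmf P) (\<lambda>_. borel) (\<lambda>i xs. g (xs i)) {..<q}"
    unfolding P_def
    by (rule prob_space.indep_vars_compose2[OF prob_space_measure_pmf
          indep_vars_Pi_pmf[of "{..<q}"]]) auto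
  \<comment> \<open>Coordinate 0 serves as the reference variable that all coordinates match in
    distribution; it exists because \<open>q > 0\<close>.\<close>
  then interpret X: Hoeffding_ineq_iid "measure_pmf P" "{..<q}" "\<lambda>i xs. g (xs i)"
      "\<lambda>xs. g (xs 0)" 0 1 "measure_pmf.expectation P (\<lambda>xs. g (xs 0))"
  proof unfold_locales
    have "xs 0 \<in> set_pmf p" if "xs \<in> set_pmf P" for xs
      using that marg[of 0] \<open>q > 0\<close> by (metis image_eqI set_map_pmf)
    then show "AE xs in measure_pmf P. g (xs 0) \<in> {0..1}"
      using g by (intro AE_pmfI) auto
  qed (use \<open>q > 0\<close> distr in auto)
  have mean: "measure_pmf.expectation P (\<lambda>xs. g (xs 0)) = measure_pmf.expectation p g"
    using marg[of 0] \<open>q > 0\<close> by (metis integral_map_pmf)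
  have "measure_pmf.prob P {xs. \<gamma> < \<bar>(\<Sum>i<q. g (xs i)) / real q - measure_pmf.expectation p g\<bar>}
      \<le> measure_pmf.prob P {xs \<in> space (measure_pmf P).
            \<gamma> \<le> \<bar>(\<Sum>i<q. g (xs i)) / real (card {..<q}) - measure_pmf.expectation P (\<lambda>xs. g (xs 0))\<bar>}"
    by (rule measure_pmf.finite_measure_mono) (auto simp: mean)
  also have "\<dots> \<le> 2 * exp (- 2 * real (card {..<q}) * \<gamma>\<^sup>2 / (1 - 0)\<^sup>2)"
    by (rule X.Hoeffding_ineq_abs_ge') (use assms in auto)
  finally show ?thesis by (simp add: P_def)
qed

section \<open>Flip cost of a formula\<close>

lemma value_of_cong:
  assumes "\<And>x. x \<in> set (leaf_vars t) \<Longrightarrow> \<sigma> x = \<tau> x"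
  shows "value_of \<sigma> t = value_of \<tau> t"
  using assms
proof (induction t)
  case (Gate f ts)
  have "map (value_of \<sigma>) ts = map (value_of \<tau>) ts"
    by (rule map_cong[OF refl]) (rule Gate.IH, auto intro!: Gate.prems)
  then show ?case by (simp only: value_of.simps)
qed auto

text \<open>Only the variables of \<open>t\<close> count, so the flips of children with disjoint
  leaves add up; the ambient variable set enters only in the final rescaling.\<close>

definition flips :: "('v \<Rightarrow> bool) \<Rightarrow> ('v \<Rightarrow> bool) \<Rightarrow> 'v formula \<Rightarrow> nat" where
  "flips \<sigma> \<tau> t = card {x \<in> set (leaf_vars t). \<sigma> x \<noteq> \<tau> x}"

text \<open>For an unsatisfiable \<open>t\<close> the \<open>LEAST\<close> is unspecified; hence the
  facts below ask for a satisfying assignment.\<close>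

definition cost :: "('v \<Rightarrow> bool) \<Rightarrow> 'v formula \<Rightarrow> nat" where
  "cost \<sigma> t = (LEAST c. \<exists>\<tau>. value_of \<tau> t \<and> flips \<sigma> \<tau> t = c)"

lemma cost_le_flips: "value_of \<tau> t \<Longrightarrow> cost \<sigma> t \<le> flips \<sigma> \<tau> t"
  unfolding cost_def by (rule Least_le) auto

lemma cost_attained:
  assumes "value_of \<tau>\<^sub>0 t"
  obtains \<tau> where "value_of \<tau> t" "flips \<sigma> \<tau> t = cost \<sigma> t"
  unfolding cost_def
  using LeastI[of "\<lambda>c. \<exists>\<tau>. value_of \<tau> t \<and> flips \<sigma> \<tau> t = c" "flips \<sigma> \<tau>\<^sub>0 t"] assms by auto

lemma flips_le_length: "flips \<sigma> \<tau> t \<le> length (leaf_vars t)"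
proof -
  have "flips \<sigma> \<tau> t \<le> card (set (leaf_vars t))"
    unfolding flips_def by (rule card_mono) auto
  also have "\<dots> \<le> length (leaf_vars t)" by (rule card_length)
  finally show ?thesis .
qed

lemma cost_le_length: "value_of \<tau> t \<Longrightarrow> cost \<sigma> t \<le> length (leaf_vars t)"
  by (rule order_trans[OF cost_le_flips flips_le_length])

lemma cost_eq_0_iff:
  assumes "value_of \<tau>\<^sub>0 t"
  shows "cost \<sigma> t = 0 \<longleftrightarrow> value_of \<sigma> t"
proof
  assume "cost \<sigma> t = 0"
  moreover obtain \<tau> where \<tau>: "value_of \<tau> t" "flips \<sigma> \<tau> t = cost \<sigma> t"
    using cost_attained[OF assms] .
  ultimately have "\<sigma> x = \<tau> x" if "x \<in> set (leaf_vars t)" for x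
    using that by (auto simp: flips_def)
  then show "value_of \<sigma> t" using value_of_cong \<tau>(1) by metis
next
  assume "value_of \<sigma> t"
  from cost_le_flips[OF this, of \<sigma>] show "cost \<sigma> t = 0" by (simp add: flips_def)
qed

section \<open>Cost of a gate in terms of its accepting sets\<close>

definition accepting :: "nat \<Rightarrow> (bool list \<Rightarrow> bool) \<Rightarrow> nat set set" where
  "accepting m f = {M. M \<subseteq> {..<m} \<and> f (map (\<lambda>j. j \<in> M) [0..<m])}"

lemma accepting_true_positions:
  assumes "length ys = m" "f ys"
  shows "{j. j < m \<and> ys ! j} \<in> accepting m f"
proof -
  have "map (\<lambda>j. j \<in> {j. j < m \<and> ys ! j}) [0..<m] = ys"
    using assms by (intro nth_equalityI) auto
  then show ?thesis using assms(2) by (auto simp: accepting_def)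
qed

lemma distinct_concat_nth_disjoint:
  assumes "distinct (concat xss)" "i < length xss" "j < length xss" "i \<noteq> j"
  shows "set (xss ! i) \<inter> set (xss ! j) = {}"
  using assms
proof (induction xss arbitrary: i j)
  case (Cons xs xss)
  have *: "set xs \<inter> set (xss ! n) = {}" if "n < length xss" for n
  proof -
    have "set (xss ! n) \<subseteq> \<Union> (set ` set xss)" using nth_mem[OF that] by blast
    then show ?thesis using Cons.prems(1) by auto
  qed
  have IH: "set (xss ! i') \<inter> set (xss ! j') = {}"
    if "i' < length xss" "j' < length xss" "i' \<noteq> j'" for i' j'
    using Cons.IH that Cons.prems(1) by simp
  show ?case
  proof (cases i)
    case 0
    then obtain j' where "j = Suc j'" using Cons.prems(4) by (cases j) auto
    then show ?thesis using 0 *[of j'] Cons.prems(3) by simp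
  next
    case (Suc i')
    show ?thesis
    proof (cases j)
      case 0
      then show ?thesis using Suc *[of i'] Cons.prems(2) by (simp add: Int_commute)
    next
      case (Suc j')
      then show ?thesis using \<open>i = Suc i'\<close> IH[of i' j'] Cons.prems(2-4) by simp
    qed
  qed
qed simp

lemma leaf_vars_nth_disjoint:
  assumes "distinct (leaf_vars (Gate f ts))" "i < length ts" "j < length ts" "i \<noteq> j"
  shows "set (leaf_vars (ts ! i)) \<inter> set (leaf_vars (ts ! j)) = {}"
  using distinct_concat_nth_disjoint[of "map leaf_vars ts" i j] assms by simp

text \<open>Each child in \<open>M\<close> follows its own assignment and all other variables keep
  their value under \<sigma>. This is consistent because the children have disjoint leaves, and
  monotonicity takes care of children outside \<open>M\<close> that happen to be true.\<close>

lemma gate_glue: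
  assumes dist: "distinct (leaf_vars (Gate f ts))"
    and mono: "monotone_gate (length ts) f"
    and M: "M \<in> accepting (length ts) f"
    and sat: "\<And>j. j \<in> M \<Longrightarrow> value_of (\<tau> j) (ts ! j)"
  obtains \<tau>' where "value_of \<tau>' (Gate f ts)"
    "flips \<sigma> \<tau>' (Gate f ts) \<le> (\<Sum>j\<in>M. flips \<sigma> (\<tau> j) (ts ! j))"
proof -
  define L where "L = (\<lambda>j. set (leaf_vars (ts ! j)))"
  define \<rho> where "\<rho> = (\<lambda>x. if \<exists>j\<in>M. x \<in> L j then \<tau> (SOME j. j \<in> M \<and> x \<in> L j) x else \<sigma> x)"
  have M': "M \<subseteq> {..<length ts}" "f (map (\<lambda>j. j \<in> M) [0..<length ts])"
    using M by (auto simp: accepting_def)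
  have \<rho>: "\<rho> x = \<tau> j x" if "j \<in> M" "x \<in> L j" for j x
  proof -
    have "(SOME i. i \<in> M \<and> x \<in> L i) = j"
    proof (rule some_equality)
      show "i = j" if "i \<in> M \<and> x \<in> L i" for i
        using leaf_vars_nth_disjoint[OF dist, of i j] that \<open>j \<in> M\<close> \<open>x \<in> L j\<close> M'(1)
        by (auto simp: L_def)
    qed (use that in auto)
    then show ?thesis using that by (auto simp: \<rho>_def)
  qed
  have "value_of \<rho> (ts ! j)" if "j \<in> M" for j
    using sat[OF that] value_of_cong[of "ts ! j" \<rho> "\<tau> j"] \<rho>[OF that] by (auto simp: L_def)
  then have "list_all2 (\<le>) (map (\<lambda>j. j \<in> M) [0..<length ts]) (map (value_of \<rho>) ts)"
    by (simp add: list_all2_conv_all_nth)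
  with mono have "f (map (\<lambda>j. j \<in> M) [0..<length ts]) \<le> f (map (value_of \<rho>) ts)"
    unfolding monotone_gate_def by (metis length_map length_upt diff_zero)
  with M'(2) have "value_of \<rho> (Gate f ts)" by simp
  moreover have "flips \<sigma> \<rho> (Gate f ts) \<le> (\<Sum>j\<in>M. flips \<sigma> (\<tau> j) (ts ! j))"
  proof -
    have fin: "finite M" using M'(1) finite_subset by blast
    have "flips \<sigma> \<rho> (Gate f ts) \<le> card (\<Union>j\<in>M. {x \<in> L j. \<sigma> x \<noteq> \<tau> j x})"
      unfolding flips_def
    proof (rule card_mono)
      show "finite (\<Union>j\<in>M. {x \<in> L j. \<sigma> x \<noteq> \<tau> j x})" using fin by (auto simp: L_def)
      show "{x \<in> set (leaf_vars (Gate f ts)). \<sigma> x \<noteq> \<rho> x} \<subseteq> (\<Union>j\<in>M. {x \<in> L j. \<sigma> x \<noteq> \<tau> j x})"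
      proof
        fix x assume "x \<in> {x \<in> set (leaf_vars (Gate f ts)). \<sigma> x \<noteq> \<rho> x}"
        then have "\<sigma> x \<noteq> \<rho> x" by simp
        then obtain j where "j \<in> M" "x \<in> L j" by (auto simp: \<rho>_def split: if_splits)
        with \<open>\<sigma> x \<noteq> \<rho> x\<close> show "x \<in> (\<Union>j\<in>M. {x \<in> L j. \<sigma> x \<noteq> \<tau> j x})" using \<rho> by auto
      qed
    qed
    also have "\<dots> \<le> (\<Sum>j\<in>M. flips \<sigma> (\<tau> j) (ts ! j))"
      unfolding flips_def L_def by (rule card_UN_le[OF fin])
    finally show ?thesis .
  qed
  ultimately show ?thesis by (rule that)
qed

lemma cost_gate_le:
  assumes "distinct (leaf_vars (Gate f ts))" "monotone_gate (length ts) f"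
    and M: "M \<in> accepting (length ts) f"
    and sat: "\<And>t. t \<in> set ts \<Longrightarrow> \<exists>\<tau>. value_of \<tau> t"
  shows "cost \<sigma> (Gate f ts) \<le> (\<Sum>j\<in>M. cost \<sigma> (ts ! j))"
proof -
  have "\<exists>\<tau>. value_of \<tau> (ts ! j) \<and> flips \<sigma> \<tau> (ts ! j) = cost \<sigma> (ts ! j)" if "j \<in> M" for j
  proof -
    have "ts ! j \<in> set ts" using that M by (auto simp: accepting_def)
    then obtain \<tau>\<^sub>0 where "value_of \<tau>\<^sub>0 (ts ! j)" using sat by blast
    from cost_attained[OF this, of \<sigma>] show ?thesis by blast
  qed
  then obtain \<tau> where \<tau>: "\<And>j. j \<in> M \<Longrightarrow> value_of (\<tau> j) (ts ! j)"
      "\<And>j. j \<in> M \<Longrightarrow> flips \<sigma> (\<tau> j) (ts ! j) = cost \<sigma> (ts ! j)"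
    by metis
  obtain \<tau>' where "value_of \<tau>' (Gate f ts)"
      "flips \<sigma> \<tau>' (Gate f ts) \<le> (\<Sum>j\<in>M. flips \<sigma> (\<tau> j) (ts ! j))"
    using gate_glue[OF assms(1-3) \<tau>(1)] .
  with cost_le_flips[OF this(1), of \<sigma>] show ?thesis by (simp add: \<tau>(2))
qed

text \<open>Let \<open>M\<close> consist of the children that an optimal assignment makes true;
  their leaves are disjoint, so their flips add up. Together with \<open>cost_gate_le\<close> this
  makes the cost of a gate a minimum over its accepting sets.\<close>

lemma cost_gate_ge:
  assumes dist: "distinct (leaf_vars (Gate f ts))" and sat: "value_of \<tau>\<^sub>0 (Gate f ts)"
  obtains M where "M \<in> accepting (length ts) f" "(\<Sum>j\<in>M. cost \<sigma> (ts ! j)) \<le> cost \<sigma> (Gate f ts)"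
proof -
  obtain \<tau> where \<tau>: "value_of \<tau> (Gate f ts)" "flips \<sigma> \<tau> (Gate f ts) = cost \<sigma> (Gate f ts)"
    using cost_attained[OF sat] .
  define M where "M = {j. j < length ts \<and> map (value_of \<tau>) ts ! j}"
  have M: "M \<in> accepting (length ts) f"
    unfolding M_def by (rule accepting_true_positions) (use \<tau>(1) in auto)
  define D where "D = (\<lambda>j. {x \<in> set (leaf_vars (ts ! j)). \<sigma> x \<noteq> \<tau> x})"
  have "(\<Sum>j\<in>M. cost \<sigma> (ts ! j)) \<le> (\<Sum>j\<in>M. card (D j))"
  proof (rule sum_mono)
    fix j assume "j \<in> M"
    then have "value_of \<tau> (ts ! j)" by (auto simp: M_def)
    from cost_le_flips[OF this] show "cost \<sigma> (ts ! j) \<le> card (D j)"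
      by (simp add: D_def flips_def)
  qed
  also have "\<dots> = card (\<Union>j\<in>M. D j)"
  proof (rule card_UN_disjoint[symmetric])
    show "\<forall>i\<in>M. \<forall>j\<in>M. i \<noteq> j \<longrightarrow> D i \<inter> D j = {}"
    proof (intro ballI impI)
      fix i j assume "i \<in> M" "j \<in> M" "i \<noteq> j"
      then show "D i \<inter> D j = {}"
        using leaf_vars_nth_disjoint[OF dist, of i j] by (auto simp: M_def D_def)
    qed
  qed (auto simp: M_def D_def)
  also have "\<dots> \<le> flips \<sigma> \<tau> (Gate f ts)"
    unfolding flips_def
  proof (rule card_mono)
    show "(\<Union>j\<in>M. D j) \<subseteq> {x \<in> set (leaf_vars (Gate f ts)). \<sigma> x \<noteq> \<tau> x}"
      using nth_mem by (fastforce simp: M_def D_def)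
  qed simp
  finally show ?thesis using M \<tau>(2) that by simp
qed

section \<open>Gates of basic formulas\<close>

lemma subformulas_child: "t \<in> set ts \<Longrightarrow> subformulas t \<subseteq> subformulas (Gate f ts)"
  by auto

lemma k_basic_child:
  assumes "k_basic k X (Gate f ts)" "t \<in> set ts"
  shows "k_basic k X t"
proof -
  have "distinct (leaf_vars t)"
    using assms by (auto simp: k_basic_def kx_basic_def read_once_def distinct_concat_iff)
  moreover have "set (leaf_vars t) \<subseteq> X"
    using assms by (auto simp: k_basic_def kx_basic_def read_once_def)
  ultimately show ?thesis
    using assms(1) subformulas_child[OF assms(2), of f]
    unfolding k_basic_def kx_basic_def read_once_def by blast
qed

lemma k_basic_leaf:
  assumes "k_basic k X t" "is_leaf t"
  obtains x where "t = Var x"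
  using assms by (cases t) (auto simp: is_leaf_def k_basic_def kx_basic_def)

lemma k_basic_distinct: "k_basic k X t \<Longrightarrow> distinct (leaf_vars t)"
  by (simp add: k_basic_def kx_basic_def read_once_def)

text \<open>No coordinate is \<open>(0,0)\<close>-forceful, expressed by accepting sets: whichever
  child is the largest, some accepting set avoids it. Disjunctions and unforceable gates share this
  property, and conjunctions lack it.\<close>

definition omittable :: "nat \<Rightarrow> (bool list \<Rightarrow> bool) \<Rightarrow> bool" where
  "omittable m f \<longleftrightarrow> (\<forall>i<m. \<exists>M\<in>accepting m f. i \<notin> M)"

lemma accepting_disj: "is_disj m f \<Longrightarrow> j < m \<Longrightarrow> {j} \<in> accepting m f"
  by (auto simp: accepting_def is_disj_def)

lemma accepting_conj: "is_conj m f \<Longrightarrow> accepting m f = {{..<m}}"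
  by (auto simp: accepting_def is_conj_def)

lemma monotone_gate_conj: "is_conj m f \<Longrightarrow> monotone_gate m f"
  by (auto simp: is_conj_def monotone_gate_def list_all2_conv_all_nth)

lemma monotone_gate_disj: "is_disj m f \<Longrightarrow> monotone_gate m f"
  by (auto simp: is_disj_def monotone_gate_def list_all2_conv_all_nth)

lemma omittable_disj:
  assumes "is_disj m f" "2 \<le> m"
  shows "omittable m f"
  unfolding omittable_def
proof (intro allI impI)
  fix i assume "i < m"
  have "{if i = 0 then 1 else 0} \<in> accepting m f"
    by (rule accepting_disj) (use assms in auto)
  then show "\<exists>M\<in>accepting m f. i \<notin> M" by (rule bexI[rotated]) auto
qed

lemma omittable_unforceable:
  assumes "unforceable m f"
  shows "omittable m f"
  unfolding omittable_def
proof (intro allI impI)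
  fix i assume "i < m"
  then have "\<not> forceful m f i False False"
    using assms unfolding unforceable_def by blast
  then obtain ys where ys: "length ys = m" "\<not> ys ! i" "f ys"
    by (auto simp: forceful_def)
  have "{j. j < m \<and> ys ! j} \<in> accepting m f"
    by (rule accepting_true_positions) (use ys in auto)
  then show "\<exists>M\<in>accepting m f. i \<notin> M" by (rule bexI[rotated]) (use ys in auto)
qed

text \<open>Disjunctions and unforceable gates form one case since \<open>omittable\<close> and
  monotonicity are what their treatment rests on; only the arity, which is unbounded for
  disjunctions, tells them apart.\<close>

lemma k_basic_gate_cases [consumes 1, case_names neg conj other]:
  assumes "k_basic k X (Gate f ts)"
  obtains (neg) x where "ts = [Var x]" "\<And>b. f [b] = (\<not> b)"
  | (conj) "2 \<le> length ts" "is_conj (length ts) f"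
  | (other) "2 \<le> length ts" "monotone_gate (length ts) f" "omittable (length ts) f"
      "length ts \<le> k \<or> is_disj (length ts) f"
proof -
  have "Gate f ts \<in> subformulas (Gate f ts)" by simp
  then have cases: "is_neg (length ts) f \<and> (\<forall>t\<in>set ts. is_leaf t) \<or>
        2 \<le> length ts \<and> (is_conj (length ts) f \<or> is_disj (length ts) f) \<or>
        2 \<le> length ts \<and> length ts \<le> k \<and> unforceable (length ts) f"
    and mono: "unforceable (length ts) f \<Longrightarrow> monotone_gate (length ts) f"
    using assms unfolding k_basic_def kx_basic_def by blast+
  from cases consider
      "is_neg (length ts) f" "\<forall>t\<in>set ts. is_leaf t"
    | "2 \<le> length ts" "is_conj (length ts) f"
    | "2 \<le> length ts" "is_disj (length ts) f"
    | "2 \<le> length ts" "length ts \<le> k" "unforceable (length ts) f"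
    by blast
  then show thesis
  proof cases
    case 1
    then obtain t where t: "ts = [t]" by (auto simp: is_neg_def length_Suc_conv)
    moreover obtain x where "t = Var x"
      using k_basic_leaf[OF k_basic_child[OF assms]] 1 t by auto
    ultimately show thesis using neg 1 by (auto simp: is_neg_def)
  next
    case 2
    then show thesis by (rule conj)
  next
    case 3
    then show thesis
      using other[OF _ monotone_gate_disj omittable_disj] by blast
  next
    case 4
    then show thesis
      using other[OF _ mono omittable_unforceable] by blast
  qed
qed

text \<open>Every gate other than a negation has an accepting set, and satisfying assignments of the
  children in it can be glued. The second part makes the denominators of rates positive.\<close>

lemma k_basic_satisfiable:
  assumes "k_basic k X t"
  shows "(\<exists>\<tau>. value_of \<tau> t) \<and> leaf_vars t \<noteq> []"
  using assms
proof (induction t)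
  case (Var x)
  then show ?case by (auto intro: exI[of _ "\<lambda>_. True"])
next
  case (Const b)
  then show ?case by (auto simp: k_basic_def kx_basic_def)
next
  case (Gate f ts)
  have IH: "\<exists>\<tau>. value_of \<tau> t" "leaf_vars t \<noteq> []" if "t \<in> set ts" for t
    using Gate.IH[OF that] k_basic_child[OF Gate.prems that] by auto
  have sat: ?case if "2 \<le> length ts" "monotone_gate (length ts) f"
    and ne: "accepting (length ts) f \<noteq> {}"
  proof -
    obtain M where M: "M \<in> accepting (length ts) f" using ne by auto
    have "\<exists>\<tau>. value_of \<tau> (ts ! j)" if "j \<in> M" for j
      using IH(1)[of "ts ! j"] that M by (auto simp: accepting_def)
    then obtain \<tau> where "\<And>j. j \<in> M \<Longrightarrow> value_of (\<tau> j) (ts ! j)" by metis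
    with gate_glue[OF k_basic_distinct[OF Gate.prems] that(2) M, of \<tau>]
    have "\<exists>\<tau>. value_of \<tau> (Gate f ts)" by blast
    moreover have "hd ts \<in> set ts" using that(1) by (cases ts) auto
    ultimately show ?case using IH(2)[of "hd ts"] by auto
  qed
  from Gate.prems show ?case
  proof (cases rule: k_basic_gate_cases)
    case (neg x)
    then show ?thesis by (auto intro: exI[of _ "\<lambda>_. False"])
  next
    case conj
    then show ?thesis by (intro sat monotone_gate_conj) (simp_all add: accepting_conj)
  next
    case other
    have "0 < length ts" using other(1) by linarith
    then have "accepting (length ts) f \<noteq> {}" using other(3) unfolding omittable_def by blast
    then show ?thesis using sat other by blast
  qed
qed

section \<open>Cost relative to the number of leaves\<close>

definition rate :: "('v \<Rightarrow> bool) \<Rightarrow> 'v formula \<Rightarrow> real" where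
  "rate \<sigma> t = real (cost \<sigma> t) / real (length (leaf_vars t))"

lemma rate_bounds: "k_basic k X t \<Longrightarrow> rate \<sigma> t \<in> {0..1}"
  using k_basic_satisfiable[of k X t] cost_le_length[of _ t \<sigma>]
  by (auto simp: rate_def divide_simps)

lemma rate_eq_0_iff: "k_basic k X t \<Longrightarrow> rate \<sigma> t = 0 \<longleftrightarrow> value_of \<sigma> t"
  using k_basic_satisfiable[of k X t] cost_eq_0_iff[of _ t \<sigma>] by (auto simp: rate_def)

lemma cost_eq_rate: "k_basic k X t \<Longrightarrow> real (cost \<sigma> t) = rate \<sigma> t * real (length (leaf_vars t))"
  using k_basic_satisfiable[of k X t] by (simp add: rate_def)

lemma length_leaf_vars_gate:
  "length (leaf_vars (Gate f ts)) = (\<Sum>j<length ts. length (leaf_vars (ts ! j)))"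
  by (simp add: length_concat comp_def sum_list_sum_nth atLeast0LessThan)

text \<open>The threshold is chosen so that children of total size at most
  \<open>(1 - h) * n\<close>, each estimated up to \<open>e * (1 + h)\<close> times its size,
  together contribute an error of at most \<open>e * n\<close>, as
  \<open>(1 + h) * (1 - h) \<le> 1\<close>.\<close>

definition trim :: "(nat \<Rightarrow> real) \<Rightarrow> nat \<Rightarrow> real \<Rightarrow> nat \<Rightarrow> nat set \<Rightarrow> nat set" where
  "trim s m h i M = (if sum s M \<le> (1 - h) * sum s {..<m} then M else M - {i})"

text \<open>
  An accepting set carrying almost the whole size would preserve the relative error of the
  children. Dropping the large child i from it is harmless: some other accepting set avoids
  i, and it can contain only few leaves outside the first set.
\<close>

lemma trimmed_Min_accuracy:
  fixes s c r :: "nat \<Rightarrow> real" and F :: "nat set set" and K a e h C :: real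
  assumes F: "F \<subseteq> Pow {..<m}"
    and s: "\<And>j. j < m \<Longrightarrow> 0 < s j"
    and c: "\<And>j. j < m \<Longrightarrow> c j \<in> {0..s j}"
    and r: "\<And>j. j < m \<Longrightarrow> \<bar>r j * s j - c j\<bar> \<le> e * (1 + h) * s j"
    and i: "i < m" "sum s {..<m} \<le> K * s i"
    and M0: "M0 \<in> F" "i \<notin> M0"
    and par: "0 < a" "a \<le> e" "e \<le> 1" "1 \<le> K" "h = a / (2 * K)"
    and C: "\<And>M. M \<in> F \<Longrightarrow> C \<le> sum c M" "\<exists>M\<in>F. sum c M \<le> C"
  shows "\<bar>Min ((\<lambda>M. (\<Sum>j\<in>trim s m h i M. r j * s j) / sum s {..<m}) ` F) - C / sum s {..<m}\<bar> \<le> e"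
proof -
  define n where "n = sum s {..<m}"
  define w where "w = (\<lambda>M. \<Sum>j\<in>trim s m h i M. r j * s j)"
  have n: "n > 0" unfolding n_def using i(1) s by (intro sum_pos) auto
  have finM: "finite M" "M \<subseteq> {..<m}" if "M \<in> F" for M
    using that F finite_subset[of M "{..<m}"] by auto
  have finF: "finite F" using F finite_subset by blast
  have h: "0 < h" using par by simp
  \<comment> \<open>The choice of \<open>h\<close> is made for this bound. Dropping child
    \<open>i\<close> saves an error of about \<open>e / K\<close>, which has to cover the coarser
    estimates, \<open>e * h\<close>, and the leaves outside the accepting set,
    \<open>h\<close>.\<close>
  have h2: "h * (1 + e) \<le> e / K"
  proof -
    have "h * (1 + e) \<le> h * 2" using h par by (intro mult_left_mono) auto
    also have "\<dots> = a / K" using par by (simp add: field_simps)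
    also have "\<dots> \<le> e / K" using par by (intro divide_right_mono) auto
    finally show ?thesis .
  qed
  have hK: "h \<le> 1 / K" using par by (simp add: field_simps)
  have s_Diff_i: "sum s M \<le> n - n / K" if "M \<subseteq> {..<m}" "i \<notin> M" for M
  proof -
    have "sum s M \<le> sum s ({..<m} - {i})"
      by (rule sum_mono2) (use that s in \<open>auto intro: less_imp_le\<close>)
    also have "\<dots> = n - s i" using i(1) by (simp add: n_def sum_diff1)
    finally have "sum s M \<le> n - s i" .
    moreover have "n / K \<le> s i" using i(2) par by (simp add: n_def field_simps)
    ultimately show ?thesis by linarith
  qed
  have trim_size: "sum s (trim s m h i M) \<le> (1 - h) * n" if "M \<in> F" for M
  proof (cases "sum s M \<le> (1 - h) * n")
    case True
    then show ?thesis by (simp add: trim_def n_def)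
  next
    case False
    have "sum s (M - {i}) \<le> n - n * (1 / K)" using s_Diff_i[of "M - {i}"] finM[OF that] by auto
    also have "\<dots> \<le> n - n * h" using hK n by (simp add: mult_left_mono del: times_divide_eq_right)
    finally show ?thesis using False by (simp add: trim_def n_def algebra_simps)
  qed
  have trim_sub: "trim s m h i M \<subseteq> M" for M by (auto simp: trim_def)
  have err: "\<bar>sum (\<lambda>j. r j * s j) N - sum c N\<bar> \<le> e * (1 + h) * sum s N" if "N \<subseteq> {..<m}" for N
  proof -
    have "\<bar>sum (\<lambda>j. r j * s j) N - sum c N\<bar> = \<bar>\<Sum>j\<in>N. r j * s j - c j\<bar>"
      by (simp add: sum_subtractf)
    also have "\<dots> \<le> (\<Sum>j\<in>N. \<bar>r j * s j - c j\<bar>)" by (rule sum_abs)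
    also have "\<dots> \<le> (\<Sum>j\<in>N. e * (1 + h) * s j)" using that r by (intro sum_mono) auto
    finally show ?thesis by (simp add: sum_distrib_left)
  qed
  have err': "e * (1 + h) * x \<le> e * n" if "x \<le> (1 - h) * n" for x
  proof -
    have "e * (1 + h) * x \<le> e * (1 + h) * ((1 - h) * n)"
      using that par h by (intro mult_left_mono) auto
    also have "\<dots> = e * n - e * n * h\<^sup>2" by (simp add: algebra_simps power2_eq_square)
    also have "\<dots> \<le> e * n" using par n by simp
    finally show ?thesis .
  qed
  \<comment> \<open>Trimming can only lower the cost, so it does no harm on this side; the other
    side needs \<open>M0\<close>.\<close>
  have upper: "w M \<le> sum c M + e * n" if "M \<in> F" for M
  proof -
    have "w M \<le> sum c (trim s m h i M) + e * (1 + h) * sum s (trim s m h i M)"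
      using err[of "trim s m h i M"] trim_sub finM[OF that] unfolding w_def by fastforce
    also have "sum c (trim s m h i M) \<le> sum c M"
      by (rule sum_mono2[OF finM(1)[OF that] trim_sub]) (use c finM(2)[OF that] in fastforce)
    finally show ?thesis using err'[OF trim_size[OF that]] by linarith
  qed
  have lower: "C \<le> w M + e * n" if M: "M \<in> F" for M
  proof (cases "sum s M \<le> (1 - h) * n")
    case True
    then have "w M = (\<Sum>j\<in>M. r j * s j)" by (simp add: w_def trim_def n_def)
    then have "sum c M \<le> w M + e * n"
      using err[of M] err'[OF True] finM[OF M] by fastforce
    then show ?thesis using C(1)[OF M] by linarith
  next
    case False
    then have w: "w M = (\<Sum>j\<in>M - {i}. r j * s j)" by (simp add: w_def trim_def n_def)
    \<comment> \<open>As \<open>M0\<close> avoids \<open>i\<close>, it lies in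
      \<open>M - {i}\<close> together with the complement of \<open>M\<close>. Since
      \<open>M\<close> exceeds the threshold, that complement has size, and thus cost, at most
      \<open>h * n\<close>.\<close>
    have "C \<le> sum c M0" using C(1)[OF M0(1)] .
    also have "\<dots> \<le> sum c ((M - {i}) \<union> ({..<m} - M))"
      by (rule sum_mono2) (use finM[OF M] finM[OF M0(1)] M0(2) c in fastforce)+
    also have "\<dots> = sum c (M - {i}) + sum c ({..<m} - M)"
      using finM[OF M] by (intro sum.union_disjoint) auto
    also have "sum c ({..<m} - M) \<le> sum s ({..<m} - M)"
      by (rule sum_mono) (use c in auto)
    also have "sum s ({..<m} - M) = n - sum s M"
      using finM[OF M] by (simp add: n_def sum_diff)
    also have "n - sum s M \<le> h * n" using False by (simp add: algebra_simps)
    also have "sum c (M - {i}) \<le> w M + e * (1 + h) * sum s (M - {i})"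
      using err[of "M - {i}"] finM[OF M] w by fastforce
    also have "e * (1 + h) * sum s (M - {i}) \<le> e * (1 + h) * (n - n / K)"
      using s_Diff_i[of "M - {i}"] finM[OF M] par h by (intro mult_left_mono) auto
    finally have "C \<le> w M + e * (1 + h) * (n - n / K) + h * n" by simp
    also have "\<dots> = w M + e * n + n * (h * (1 + e) - e / K - e * h / K)"
      by (simp add: algebra_simps)
    also have "n * (h * (1 + e) - e / K - e * h / K) \<le> 0"
    proof (rule mult_nonneg_nonpos)
      have "0 \<le> e * h / K" using h par(1-4) by simp
      then show "h * (1 + e) - e / K - e * h / K \<le> 0" using h2 by linarith
    qed (use n in simp)
    finally show ?thesis by simp
  qed
  let ?w = "\<lambda>M. w M / n"
  have ne: "?w ` F \<noteq> {}" "finite (?w ` F)" using M0(1) finF by auto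
  obtain M1 where M1: "M1 \<in> F" "Min (?w ` F) = ?w M1" using Min_in[OF ne(2,1)] by auto
  obtain M2 where M2: "M2 \<in> F" "sum c M2 \<le> C" using C(2) by auto
  have "?w M1 \<le> ?w M2" using M1 M2 ne by (metis Min_le imageI)
  also have "\<dots> \<le> (C + e * n) / n"
    using upper[OF M2(1)] M2(2) n by (intro divide_right_mono) auto
  finally have "?w M1 \<le> C / n + e" using n by (simp add: field_simps)
  moreover have "C / n - e \<le> ?w M1"
  proof -
    have "C / n \<le> (w M1 + e * n) / n"
      using lower[OF M1(1)] n by (intro divide_right_mono) auto
    then show ?thesis using n by (simp add: add_divide_distrib)
  qed
  ultimately have "\<bar>Min (?w ` F) - C / n\<bar> \<le> e" using M1(2) by linarith
  then show ?thesis by (simp add: w_def n_def)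
qed

lemma estimator_gate:
  assumes kb: "k_basic k X (Gate f ts)"
    and gate: "2 \<le> length ts" "monotone_gate (length ts) f" "omittable (length ts) f"
    and K: "real (length ts) \<le> K"
    and par: "0 < a" "a \<le> e" "e \<le> 1" "h = a / (2 * K)"
    and p: "\<And>t. t \<in> set ts \<Longrightarrow> estimator (set (leaf_vars t)) W (e * (1 + h)) b (\<lambda>\<sigma>. rate \<sigma> t) (p t)"
  shows "\<exists>p'. estimator (set (leaf_vars (Gate f ts))) (real (length ts) * W) e
                (real (length ts) * b) (\<lambda>\<sigma>. rate \<sigma> (Gate f ts)) p'"
proof -
  define m where "m = length ts"
  define s where "s = (\<lambda>j. real (length (leaf_vars (ts ! j))))"
  define F where "F = accepting m f"
  define n where "n = sum s {..<m}"
  have m: "0 < m" using gate(1) unfolding m_def by linarith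
  have kbj: "k_basic k X (ts ! j)" if "j < m" for j
    using k_basic_child[OF kb] that by (simp add: m_def)
  have s: "0 < s j" if "j < m" for j
    using k_basic_satisfiable[OF kbj[OF that]] by (simp add: s_def)
  have n: "n > 0" unfolding n_def using m s by (intro sum_pos) auto
  have n_eq: "real (length (leaf_vars (Gate f ts))) = n"
    unfolding length_leaf_vars_gate n_def s_def m_def by simp
  have F: "F \<subseteq> Pow {..<m}" by (auto simp: F_def accepting_def)
  have finF: "finite F" using F finite_subset by blast
  \<comment> \<open>The child to be dropped is the largest one; by averaging it holds at least the
    fraction \<open>1 / K\<close> of the leaves.\<close>
  have "Max (s ` {..<m}) \<in> s ` {..<m}" using m by (intro Max_in) auto
  then obtain i where i: "i < m" "s i = Max (s ` {..<m})" by auto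
  have "n \<le> (\<Sum>j<m. s i)" unfolding n_def by (rule sum_mono) (simp add: i(2))
  also have "\<dots> \<le> K * s i" using K s[OF i(1)] by (simp add: m_def)
  finally have nK: "sum s {..<m} \<le> K * s i" by (simp add: n_def)
  obtain M0 where M0: "M0 \<in> F" "i \<notin> M0"
    using gate(3) i(1) by (auto simp: omittable_def F_def m_def)
  define w where "w = (\<lambda>r M. (\<Sum>j\<in>trim s m h i M. r j * s j) / sum s {..<m})"
  define G where "G = (\<lambda>r. Min (w r ` F))"
  have trim: "trim s m h i M \<subseteq> {..<m}" "trim s m h i M \<subseteq> M" if "M \<in> F" for M
    using F that by (auto simp: trim_def split: if_splits)
  have w_range: "w r M \<in> {0..1}" if "M \<in> F" "\<And>j. j < m \<Longrightarrow> r j \<in> {0..1}" for r M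
  proof -
    have "0 \<le> (\<Sum>j\<in>trim s m h i M. r j * s j)"
      using trim[OF that(1)] that(2) s by (intro sum_nonneg) (force intro: mult_nonneg_nonneg less_imp_le)
    moreover have "(\<Sum>j\<in>trim s m h i M. r j * s j) \<le> (\<Sum>j\<in>trim s m h i M. s j)"
      using trim[OF that(1)] that(2) s by (intro sum_mono mult_left_le_one_le) (force intro: less_imp_le)+
    moreover have "\<dots> \<le> n"
      unfolding n_def using trim[OF that(1)] s by (intro sum_mono2) (auto intro: less_imp_le)
    ultimately show ?thesis using n by (simp add: w_def n_def[symmetric])
  qed
  have G_range: "G r \<in> {0..1}" if "\<And>j. j < m \<Longrightarrow> r j \<in> {0..1}" for r
  proof -
    have "G r \<in> w r ` F" unfolding G_def using M0(1) finF by (intro Min_in) auto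
    then obtain M where "M \<in> F" "G r = w r M" by auto
    then show ?thesis using w_range[OF _ that] by simp
  qed
  have "\<exists>p'. estimator (set (leaf_vars (Gate f ts))) (real m * W) e (real m * b)
               (\<lambda>\<sigma>. rate \<sigma> (Gate f ts)) p'"
  proof (rule estimator_combine[where v = "\<lambda>j \<sigma>. rate \<sigma> (ts ! j)" and e = "e * (1 + h)"
        and p = "\<lambda>j. p (ts ! j)" and G = G])
    fix j assume j: "j < m"
    then have "ts ! j \<in> set ts" by (simp add: m_def)
    from p[OF this] this show "estimator (set (leaf_vars (Gate f ts))) W (e * (1 + h)) b
        (\<lambda>\<sigma>. rate \<sigma> (ts ! j)) (p (ts ! j))"
      by (elim estimator_mono) auto
  next
    fix r :: "nat \<Rightarrow> real" assume "\<And>j. j < m \<Longrightarrow> r j \<in> {0..1}"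
    then show "G r \<in> {0..1}" by (rule G_range)
  next
    fix \<sigma> :: "'a \<Rightarrow> bool" and r :: "nat \<Rightarrow> real"
    assume 0: "rate \<sigma> (Gate f ts) = 0" "\<And>j. j < m \<Longrightarrow> rate \<sigma> (ts ! j) = 0 \<Longrightarrow> r j = 0"
      and r: "\<And>j. j < m \<Longrightarrow> r j \<in> {0..1}"
    \<comment> \<open>One-sidedness: if \<sigma> satisfies the gate, its true children form an
      accepting set, and all their estimates are 0. Trimming only shrinks this set, so the minimum
      is 0.\<close>
    define M where "M = {j. j < m \<and> map (value_of \<sigma>) ts ! j}"
    have M: "M \<in> F"
      unfolding M_def F_def
      by (rule accepting_true_positions) (use 0(1) rate_eq_0_iff[OF kb] in \<open>auto simp: m_def\<close>)
    have "r j = 0" if "j \<in> M" for j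
      using 0(2) rate_eq_0_iff[OF kbj] that by (auto simp: M_def m_def)
    then have "w r M = 0" using trim[OF M] by (force simp: w_def intro: sum.neutral)
    moreover have "G r \<le> w r M" unfolding G_def using M finF by (intro Min_le) auto
    ultimately show "G r = 0" using G_range[of r, OF r] by auto
  next
    fix \<sigma> :: "'a \<Rightarrow> bool" and r :: "nat \<Rightarrow> real"
    assume r: "\<And>j. j < m \<Longrightarrow> \<bar>r j - rate \<sigma> (ts ! j)\<bar> \<le> e * (1 + h)"
    have sat: "\<exists>\<tau>. value_of \<tau> t" if "t \<in> set ts" for t
      using k_basic_satisfiable[OF k_basic_child[OF kb that]] by blast
    have "\<bar>Min ((\<lambda>M. (\<Sum>j\<in>trim s m h i M. r j * s j) / sum s {..<m}) ` F)
           - real (cost \<sigma> (Gate f ts)) / sum s {..<m}\<bar> \<le> e"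
    proof (rule trimmed_Min_accuracy[where c = "\<lambda>j. real (cost \<sigma> (ts ! j))", OF F s _ _ i(1) nK M0])
      fix j assume j: "j < m"
      show "real (cost \<sigma> (ts ! j)) \<in> {0..s j}"
        using cost_le_length k_basic_satisfiable[OF kbj[OF j]] by (auto simp: s_def)
      have "\<bar>r j * s j - real (cost \<sigma> (ts ! j))\<bar> = \<bar>r j - rate \<sigma> (ts ! j)\<bar> * s j"
        using s[OF j] by (simp add: cost_eq_rate[OF kbj[OF j]] s_def abs_mult flip: left_diff_distrib)
      also have "\<dots> \<le> e * (1 + h) * s j"
        using r[OF j] s[OF j] by (intro mult_right_mono) auto
      finally show "\<bar>r j * s j - real (cost \<sigma> (ts ! j))\<bar> \<le> e * (1 + h) * s j" .
    next
      show "1 \<le> K" using K gate(1) by linarith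
      show "real (cost \<sigma> (Gate f ts)) \<le> (\<Sum>j\<in>M. real (cost \<sigma> (ts ! j)))" if "M \<in> F" for M
        using cost_gate_le[OF k_basic_distinct[OF kb] gate(2) that[unfolded F_def m_def] sat, of \<sigma>]
        by (simp flip: of_nat_sum)
      obtain \<tau>\<^sub>0 where "value_of \<tau>\<^sub>0 (Gate f ts)" using k_basic_satisfiable[OF kb] by blast
      from cost_gate_ge[OF k_basic_distinct[OF kb] this, of \<sigma>]
      obtain M where "M \<in> F" "(\<Sum>j\<in>M. cost \<sigma> (ts ! j)) \<le> cost \<sigma> (Gate f ts)"
        by (auto simp: F_def m_def)
      then show "\<exists>M\<in>F. (\<Sum>j\<in>M. real (cost \<sigma> (ts ! j))) \<le> real (cost \<sigma> (Gate f ts))"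
        by (intro bexI[of _ M]) (simp_all flip: of_nat_sum)
    qed (use par in auto)
    then show "\<bar>G r - rate \<sigma> (Gate f ts)\<bar> \<le> e"
      by (simp add: G_def w_def rate_def n_eq n_def del: leaf_vars.simps)
  next
    fix r r' :: "nat \<Rightarrow> real" assume eq: "\<And>j. j < m \<Longrightarrow> r j = r' j"
    have "w r M = w r' M" if "M \<in> F" for M
      unfolding w_def using trim[OF that] eq by (intro arg_cong2[where f = "(/)"] sum.cong) auto
    then show "G r = G r'" unfolding G_def by (simp cong: image_cong)
  qed
  then show ?thesis by (simp only: m_def)
qed

section \<open>Disjunctions of large arity and conjunctions\<close>

lemma rate_disj_le:
  assumes kb: "k_basic k X (Gate f ts)" and disj: "is_disj (length ts) f"
    and K: "0 < K" "K \<le> real (length ts)"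
  shows "rate \<sigma> (Gate f ts) \<le> 1 / K"
proof -
  define m where "m = length ts"
  define s where "s = (\<lambda>j. length (leaf_vars (ts ! j)))"
  have m: "m > 0" using K unfolding m_def by linarith
  have sat: "\<exists>\<tau>. value_of \<tau> t" if "t \<in> set ts" for t
    using k_basic_satisfiable[OF k_basic_child[OF kb that]] by blast
  \<comment> \<open>By averaging, the smallest child has at most the fraction \<open>1 / m\<close>
    of the leaves, and its cost is at most its number of leaves.\<close>
  have "Min (s ` {..<m}) \<in> s ` {..<m}" using m by (intro Min_in) auto
  then obtain i where i: "i < m" "s i = Min (s ` {..<m})" by auto
  have "m * s i = (\<Sum>j<m. s i)" by simp
  also have "\<dots> \<le> (\<Sum>j<m. s j)" by (rule sum_mono) (simp add: i(2))
  also have "\<dots> = length (leaf_vars (Gate f ts))"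
    unfolding length_leaf_vars_gate s_def m_def ..
  finally have ms: "m * s i \<le> length (leaf_vars (Gate f ts))" .
  have "cost \<sigma> (Gate f ts) \<le> (\<Sum>j\<in>{i}. cost \<sigma> (ts ! j))"
    using i(1) by (intro cost_gate_le[OF k_basic_distinct[OF kb] monotone_gate_disj[OF disj]
          accepting_disj[OF disj] sat]) (auto simp: m_def)
  also have "\<dots> \<le> s i"
    using sat[of "ts ! i"] cost_le_length i(1) by (auto simp: m_def s_def)
  finally have "K * real (cost \<sigma> (Gate f ts)) \<le> real m * real (s i)"
    using K by (intro mult_mono) (auto simp: m_def)
  also have "\<dots> \<le> real (length (leaf_vars (Gate f ts)))"
    using ms by (metis of_nat_le_iff of_nat_mult)
  finally have "K * real (cost \<sigma> (Gate f ts)) \<le> real (length (leaf_vars (Gate f ts)))" .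
  moreover have "real (length (leaf_vars (Gate f ts))) > 0"
    using k_basic_satisfiable[OF kb] by (simp del: leaf_vars.simps)
  ultimately show ?thesis using K(1) by (simp add: rate_def field_simps del: leaf_vars.simps)
qed

lemma cost_conj:
  assumes kb: "k_basic k X (Gate f ts)" and conj: "is_conj (length ts) f"
  shows "cost \<sigma> (Gate f ts) = (\<Sum>j<length ts. cost \<sigma> (ts ! j))"
proof (rule antisym)
  show "cost \<sigma> (Gate f ts) \<le> (\<Sum>j<length ts. cost \<sigma> (ts ! j))"
    using k_basic_satisfiable[OF k_basic_child[OF kb]] accepting_conj[OF conj]
    by (intro cost_gate_le[OF k_basic_distinct[OF kb] monotone_gate_conj[OF conj]]) auto
  obtain \<tau>\<^sub>0 where "value_of \<tau>\<^sub>0 (Gate f ts)" using k_basic_satisfiable[OF kb] by blast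
  from cost_gate_ge[OF k_basic_distinct[OF kb] this, of \<sigma>]
  obtain M where "M \<in> accepting (length ts) f" "(\<Sum>j\<in>M. cost \<sigma> (ts ! j)) \<le> cost \<sigma> (Gate f ts)" .
  then show "(\<Sum>j<length ts. cost \<sigma> (ts ! j)) \<le> cost \<sigma> (Gate f ts)"
    by (simp add: accepting_conj[OF conj])
qed

text \<open>
  A uniformly random leaf selects a child with probability proportional to its size, so the
  mean of the rates of the selected children is the rate of the conjunction.
\<close>

lemma estimator_conj:
  fixes W b e \<gamma> :: real
  assumes kb: "k_basic k X (Gate f ts)" and conj: "is_conj (length ts) f"
    and p: "\<And>t. t \<in> set ts \<Longrightarrow> estimator (set (leaf_vars t)) W e b (\<lambda>\<sigma>. rate \<sigma> t) (p t)"
    and q: "0 < q" and "0 \<le> \<gamma>" "0 \<le> b"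
  shows "\<exists>p'. estimator (set (leaf_vars (Gate f ts))) (real q * W) (e + \<gamma>)
                (real q * b + 2 * exp (- 2 * real q * \<gamma>\<^sup>2)) (\<lambda>\<sigma>. rate \<sigma> (Gate f ts)) p'"
proof -
  define m where "m = length ts"
  define L where "L = (\<lambda>j. set (leaf_vars (ts ! j)))"
  define V where "V = set (leaf_vars (Gate f ts))"
  define idx where "idx = (\<lambda>x. SOME j. j < m \<and> x \<in> L j)"
  define p0 where "p0 = pmf_of_set V"
  define g where "g = (\<lambda>\<sigma> x. rate \<sigma> (ts ! idx x))"
  define P where "P = Pi_pmf {..<q} undefined (\<lambda>_. p0)"
  define avg where "avg = (\<lambda>xs \<sigma>. (\<Sum>i<q. g \<sigma> (xs i)) / real q)"
  have V: "finite V" "V \<noteq> {}"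
    using k_basic_satisfiable[OF kb] by (auto simp: V_def simp del: leaf_vars.simps)
  have V_UN: "V = (\<Union>j<m. L j)"
    by (force simp: V_def L_def m_def in_set_conv_nth)
  have disj: "L i \<inter> L j = {}" if "i < m" "j < m" "i \<noteq> j" for i j
    using leaf_vars_nth_disjoint[OF k_basic_distinct[OF kb], of i j] that
    unfolding L_def m_def by blast
  have kbj: "k_basic k X (ts ! j)" if "j < m" for j
    using k_basic_child[OF kb] that by (simp add: m_def)
  have idx_eq: "idx x = j" if "j < m" "x \<in> L j" for x j
    unfolding idx_def by (rule some_equality) (use that disj in blast)+
  have idx: "idx x < m" "x \<in> L (idx x)" if "x \<in> V" for x
    using that idx_eq by (auto simp: V_UN)
  have set_p0: "set_pmf p0 = V" using V by (simp add: p0_def)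
  have set_P: "xs i \<in> V" if "xs \<in> set_pmf P" "i < q" for xs i
    using that set_Pi_pmf[of "{..<q}" undefined "\<lambda>_. p0"] set_p0
    unfolding P_def by (auto simp: PiE_dflt_def)
  have mean: "measure_pmf.expectation p0 (g \<sigma>) = rate \<sigma> (Gate f ts)" for \<sigma>
  proof -
    have "sum (g \<sigma>) V = (\<Sum>j<m. sum (g \<sigma>) (L j))"
      unfolding V_UN by (rule sum.UNION_disjoint) (use disj in \<open>auto simp: L_def\<close>)
    also have "\<dots> = (\<Sum>j<m. real (cost \<sigma> (ts ! j)))"
    proof (rule sum.cong[OF refl])
      fix j assume "j \<in> {..<m}"
      then have j: "j < m" by simp
      have "sum (g \<sigma>) (L j) = (\<Sum>x\<in>L j. rate \<sigma> (ts ! j))"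
        by (rule sum.cong[OF refl]) (simp add: g_def idx_eq[OF j])
      also have "\<dots> = rate \<sigma> (ts ! j) * real (length (leaf_vars (ts ! j)))"
        by (simp add: L_def distinct_card[OF k_basic_distinct[OF kbj[OF j]]])
      finally show "sum (g \<sigma>) (L j) = real (cost \<sigma> (ts ! j))"
        by (simp add: cost_eq_rate[OF kbj[OF j]])
    qed
    also have "\<dots> = real (cost \<sigma> (Gate f ts))"
      by (simp add: cost_conj[OF kb conj] m_def)
    finally have "sum (g \<sigma>) V = real (cost \<sigma> (Gate f ts))" .
    moreover have "card V = length (leaf_vars (Gate f ts))"
      unfolding V_def by (rule distinct_card[OF k_basic_distinct[OF kb]])
    ultimately show ?thesis
      unfolding p0_def rate_def by (simp add: integral_pmf_of_set[OF V(2,1)] del: leaf_vars.simps)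
  qed
  \<comment> \<open>For a fixed sample \<open>xs\<close> the average rate of the selected children
    is a quantity to be estimated like any other; a child selected several times is estimated anew
    each time.\<close>
  have "\<exists>p'. estimator V (real q * W) e (real q * b) (avg xs) p'" if xs: "xs \<in> set_pmf P" for xs
  proof (rule estimator_combine[where v = "\<lambda>i \<sigma>. g \<sigma> (xs i)" and e = e
        and p = "\<lambda>i. p (ts ! idx (xs i))" and G = "\<lambda>r. (\<Sum>i<q. r i) / real q"])
    fix i assume i: "i < q"
    have "ts ! idx (xs i) \<in> set ts" using idx(1)[OF set_P[OF xs i]] by (simp add: m_def)
    from p[OF this] this show "estimator V W e b (\<lambda>\<sigma>. g \<sigma> (xs i)) (p (ts ! idx (xs i)))"
      unfolding g_def by (elim estimator_mono) (auto simp: V_def)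
  next
    fix r :: "nat \<Rightarrow> real" assume r: "\<And>i. i < q \<Longrightarrow> r i \<in> {0..1}"
    have "(\<Sum>i<q. r i) \<le> (\<Sum>i<q. 1)" by (rule sum_mono) (use r in auto)
    moreover have "0 \<le> (\<Sum>i<q. r i)" by (rule sum_nonneg) (use r in auto)
    ultimately show "(\<Sum>i<q. r i) / real q \<in> {0..1}" using q by simp
  next
    fix \<sigma> and r :: "nat \<Rightarrow> real"
    assume 0: "avg xs \<sigma> = 0" "\<And>i. i < q \<Longrightarrow> g \<sigma> (xs i) = 0 \<Longrightarrow> r i = 0"
    have "(\<Sum>i<q. g \<sigma> (xs i)) = 0" using 0(1) q by (simp add: avg_def)
    moreover have "0 \<le> g \<sigma> (xs i)" if "i < q" for i
      using rate_bounds[OF kbj[OF idx(1)[OF set_P[OF xs that]]]] by (simp add: g_def)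
    ultimately have "g \<sigma> (xs i) = 0" if "i < q" for i
      using that by (subst (asm) sum_nonneg_eq_0_iff) auto
    then show "(\<Sum>i<q. r i) / real q = 0" using 0(2) by simp
  next
    fix \<sigma> and r :: "nat \<Rightarrow> real"
    assume r: "\<And>i. i < q \<Longrightarrow> \<bar>r i - g \<sigma> (xs i)\<bar> \<le> e"
    have "\<bar>(\<Sum>i<q. r i) - (\<Sum>i<q. g \<sigma> (xs i))\<bar> \<le> (\<Sum>i<q. \<bar>r i - g \<sigma> (xs i)\<bar>)"
      unfolding sum_subtractf[symmetric] by (rule sum_abs)
    also have "\<dots> \<le> (\<Sum>i<q. e)" by (rule sum_mono) (use r in auto)
    finally have "\<bar>((\<Sum>i<q. r i) - (\<Sum>i<q. g \<sigma> (xs i))) / real q\<bar> \<le> e"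
      using q by (simp add: field_simps abs_divide)
    then show "\<bar>(\<Sum>i<q. r i) / real q - avg xs \<sigma>\<bar> \<le> e"
      by (simp add: avg_def diff_divide_distrib)
  qed (auto intro: arg_cong2[where f = "(/)"] sum.cong)
  then obtain F where F: "\<And>xs. xs \<in> set_pmf P \<Longrightarrow> estimator V (real q * W) e (real q * b) (avg xs) (F xs)"
    by metis
  have "estimator V (real q * W) (e + \<gamma>) (real q * b + 2 * exp (- 2 * real q * \<gamma>\<^sup>2))
          (\<lambda>\<sigma>. rate \<sigma> (Gate f ts)) (bind_pmf P F)"
  proof (rule estimator_mixture[where v = avg])
    show "estimator V (real q * W) e (real q * b) (avg xs) (F xs)" if "xs \<in> set_pmf P" for xs
      by (rule F[OF that])
  next
    fix xs \<sigma> assume xs: "xs \<in> set_pmf P" and 0: "rate \<sigma> (Gate f ts) = 0"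
    \<comment> \<open>Costs add up at a conjunction, so cost 0 forces every child to have rate 0,
      and every possible sample has average 0.\<close>
    have "cost \<sigma> (Gate f ts) = 0"
      using 0 k_basic_satisfiable[OF kb] by (simp add: rate_def del: leaf_vars.simps)
    then have "rate \<sigma> (ts ! j) = 0" if "j < m" for j
      using that by (simp add: cost_conj[OF kb conj] m_def rate_def)
    then show "avg xs \<sigma> = 0"
      using idx(1)[OF set_P[OF xs]] by (simp add: avg_def g_def)
  next
    fix \<sigma>
    have "measure_pmf.prob (Pi_pmf {..<q} undefined (\<lambda>_. p0))
           {xs. \<gamma> < \<bar>(\<Sum>i<q. g \<sigma> (xs i)) / real q - measure_pmf.expectation p0 (g \<sigma>)\<bar>}
         \<le> 2 * exp (- 2 * real q * \<gamma>\<^sup>2)"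
    proof (rule hoeffding_Pi_pmf)
      fix x assume "x \<in> set_pmf p0"
      then show "g \<sigma> x \<in> {0..1}"
        using rate_bounds[OF kbj[OF idx(1)]] set_p0 by (simp add: g_def)
    qed fact+
    then show "measure_pmf.prob P {xs. \<gamma> < \<bar>avg xs \<sigma> - rate \<sigma> (Gate f ts)\<bar>}
        \<le> 2 * exp (- 2 * real q * \<gamma>\<^sup>2)"
      by (simp add: mean P_def avg_def)
  qed (use \<open>0 \<le> b\<close> in auto)
  then show ?thesis unfolding V_def by blast
qed

section \<open>Formulas that need at most one query\<close>

lemma rate_single_leaf:
  assumes "k_basic k X t" "length (leaf_vars t) = 1"
  shows "rate \<sigma> t = (if value_of \<sigma> t then 0 else 1)"
proof -
  obtain \<tau> where \<tau>: "value_of \<tau> t" using k_basic_satisfiable[OF assms(1)] by blast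
  show ?thesis
    using cost_le_length[OF \<tau>, of \<sigma>] cost_eq_0_iff[OF \<tau>, of \<sigma>] assms(2)
    by (auto simp: rate_def le_Suc_eq)
qed

lemma estimator_query:
  assumes kb: "k_basic k X t" and x: "leaf_vars t = [x]"
    and val: "\<And>\<sigma>. value_of \<sigma> t = (\<sigma> x = c)" and par: "1 \<le> W" "0 \<le> e" "0 \<le> b"
  shows "\<exists>p. estimator (set (leaf_vars t)) W e b (\<lambda>\<sigma>. rate \<sigma> t) p"
proof (rule exI, rule estimator_return)
  let ?T = "Query x (Output (if c then 1 else 0)) (Output (if c then 0 else 1)) :: ('a, real) dtree"
  fix \<sigma>
  show "set (queries ?T \<sigma>) \<subseteq> set (leaf_vars t)" "real (length (queries ?T \<sigma>)) \<le> W"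
    using x par by auto
  have "run ?T \<sigma> = rate \<sigma> t" using rate_single_leaf[OF kb] x val by auto
  then show "run ?T \<sigma> \<in> {0..1}" "rate \<sigma> t = 0 \<Longrightarrow> run ?T \<sigma> = 0" "\<bar>run ?T \<sigma> - rate \<sigma> t\<bar> \<le> e"
    using par rate_bounds[OF kb] by auto
qed fact

text \<open>The constant 0 is one-sided whatever the rate is. It answers the cases in which the
  accuracy is at least 1 or a disjunction has large arity.\<close>

lemma estimator_zero:
  assumes "k_basic k X t" "\<And>\<sigma>. rate \<sigma> t \<le> e" "0 \<le> W" "0 \<le> b"
  shows "\<exists>p. estimator (set (leaf_vars t)) W e b (\<lambda>\<sigma>. rate \<sigma> t) p"
  using assms rate_bounds[OF assms(1)]
  by (intro exI[of _ "return_pmf (Output 0)"] estimator_return) auto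

lemma estimator_non_conj:
  assumes kb: "k_basic k X t"
    and nc: "\<And>f ts. t = Gate f ts \<Longrightarrow> \<not> is_conj (length ts) f"
    and K: "real k \<le> K" "1 \<le> K" "1 \<le> a * K"
    and par: "0 < a" "a \<le> e" "h = a / (2 * K)" "1 \<le> W" "0 \<le> b"
    and ex: "\<And>u. k_basic k X u \<Longrightarrow> \<exists>p. estimator (set (leaf_vars u)) W (e * (1 + h)) b (\<lambda>\<sigma>. rate \<sigma> u) p"
  shows "\<exists>p. estimator (set (leaf_vars t)) (K * W) e (K * b) (\<lambda>\<sigma>. rate \<sigma> t) p"
proof -
  have KW: "1 \<le> K * W" using K par mult_mono[of 1 K 1 W] by simp
  have Kb: "0 \<le> K * b" using K par by simp
  show ?thesis
  proof (cases t)
    case (Var x)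
    then show ?thesis
      using kb KW Kb par by (intro estimator_query[where x = x and c = True]) auto
  next
    case (Const c)
    then show ?thesis using kb by (auto simp: k_basic_def kx_basic_def)
  next
    case (Gate f ts)
    note kb' = kb[unfolded Gate]
    from kb' show ?thesis
    proof (cases rule: k_basic_gate_cases)
      case (neg x)
      then show ?thesis
        using kb' KW Kb par unfolding Gate
        by (intro estimator_query[where x = x and c = False]) auto
    next
      case conj
      then show ?thesis using nc[OF Gate] by blast
    next
      case other
      show ?thesis
      proof (cases "e \<le> 1")
        case False
        have "rate \<sigma> t \<le> e" for \<sigma>
          using rate_bounds[OF kb, of \<sigma>] False by auto
        then show ?thesis using KW Kb by (intro estimator_zero[OF kb]) auto
      next
        case e: True
        show ?thesis
        proof (cases "real (length ts) \<le> K")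
          case True
          obtain p where "\<And>u. k_basic k X u \<Longrightarrow>
              estimator (set (leaf_vars u)) W (e * (1 + h)) b (\<lambda>\<sigma>. rate \<sigma> u) (p u)"
            using ex by metis
          with estimator_gate[OF kb' other(1-3) True par(1,2) e par(3)] k_basic_child[OF kb']
          obtain p' where p': "estimator (set (leaf_vars t)) (real (length ts) * W) e
              (real (length ts) * b) (\<lambda>\<sigma>. rate \<sigma> t) p'"
            unfolding Gate by metis
          have "estimator (set (leaf_vars t)) (K * W) e (K * b) (\<lambda>\<sigma>. rate \<sigma> t) p'"
            by (rule estimator_mono[OF p']) (use True par in \<open>auto intro: mult_right_mono\<close>)
          then show ?thesis ..
        next
          case False
          then have disj: "is_disj (length ts) f" using other(4) K by linarith
          have "rate \<sigma> t \<le> e" for \<sigma>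
          proof -
            have "rate \<sigma> t \<le> 1 / K"
              unfolding Gate by (rule rate_disj_le[OF kb' disj]) (use K False in auto)
            also have "\<dots> \<le> a" using K by (simp add: field_simps)
            finally show ?thesis using par by linarith
          qed
          then show ?thesis using KW Kb by (intro estimator_zero[OF kb]) auto
        qed
      qed
    qed
  qed
qed

section \<open>Recursion on the accuracy\<close>

text \<open>
  The accuracy improves by the factor 1 + h at every gate that is not a conjunction. A
  conjunction spends at most e h / 8 of it on sampling, and none of its children is a conjunction.
\<close>

lemma estimator_recursion:
  fixes K a h \<gamma> \<beta> Q :: real and q l :: nat
  assumes K: "real k \<le> K" "1 \<le> K" "1 \<le> a * K"
    and par: "0 < a" "h = a / (2 * K)" "h \<le> 1" "0 < q" "\<gamma> = a * h / 4"
      "\<beta> = 2 * exp (- 2 * real q * \<gamma>\<^sup>2)" "Q = 2 * real q * K"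
    and t: "k_basic k X t" and e: "2 * a \<le> e" "1 \<le> e * (1 + h / 2) ^ l"
  shows "\<exists>p. estimator (set (leaf_vars t)) (Q ^ l) e (\<beta> * Q ^ l) (\<lambda>\<sigma>. rate \<sigma> t) p"
  using t e
proof (induction l arbitrary: t e)
  case 0
  have "rate \<sigma> t \<le> e" for \<sigma>
    using rate_bounds[OF 0(1), of \<sigma>] 0(3) by auto
  then show ?case using par by (intro estimator_zero[OF 0(1)]) auto
next
  case (Suc l)
  have h: "0 < h" using par K by simp
  have \<beta>: "0 \<le> \<beta>" using par by simp
  have qK: "1 \<le> real q * K" using par(4) K(2) mult_mono[of 1 "real q" 1 K] by simp
  have Q: "1 \<le> Q" using qK par(7) by simp
  have Ql: "1 \<le> Q ^ l" using Q by simp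
  have \<gamma>: "0 < \<gamma>" unfolding par(5) using par(1) h by simp
  have e8: "\<gamma> \<le> e * h / 8"
    using mult_right_mono[OF Suc.prems(2) less_imp_le[OF h]] unfolding par(5) by simp
  \<comment> \<open>The factor 2 in \<open>2 * a \<le> e\<close> leaves room for the sampling error:
    the reduced accuracy is still at least \<open>a\<close>.\<close>
  have "e * h \<le> e * 1" using Suc.prems(2) par by (intro mult_left_mono) auto
  then have ea: "a \<le> e - \<gamma>" using e8 Suc.prems(2) par(1) by linarith
  \<comment> \<open>This serves \<open>t\<close> itself, with \<open>e' = e\<close>, and the
    children of a conjunction, with \<open>e' = e - \<gamma>\<close>.\<close>
  have step: "\<exists>p. estimator (set (leaf_vars u)) (K * Q ^ l) e' (K * (\<beta> * Q ^ l)) (\<lambda>\<sigma>. rate \<sigma> u) p"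
    if u: "k_basic k X u" "\<And>f ts. u = Gate f ts \<Longrightarrow> \<not> is_conj (length ts) f"
      and e': "e - \<gamma> \<le> e'" for u e'
  proof (rule estimator_non_conj[OF u K par(1) _ par(2) Ql])
    \<comment> \<open>Even after a loss of \<open>e * h / 8\<close> the factor \<open>1 + h\<close>
      leaves a net growth of \<open>1 + h / 2\<close>: what is gained is
      \<open>7 / 8 * (e * h)\<close> minus at most \<open>e * h / 8\<close>, because
      \<open>h \<le> 1\<close>.\<close>
    have "e * h * h \<le> e * h * 1" "0 \<le> e * h"
      using Suc.prems(2) par(1,3) h by (auto intro: mult_left_mono)
    moreover have "(e - e * h / 8) * (1 + h) \<le> e' * (1 + h)"
      using e' e8 h by (intro mult_right_mono) auto
    moreover have "(e - e * h / 8) * (1 + h) = e + 7 / 8 * (e * h) - (e * h * h) / 8"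
      by (simp add: field_simps)
    ultimately have grow: "e * (1 + h / 2) \<le> e' * (1 + h)"
      by (simp add: distrib_left)
    fix w assume w: "k_basic k X w"
    show "\<exists>p. estimator (set (leaf_vars w)) (Q ^ l) (e' * (1 + h)) (\<beta> * Q ^ l) (\<lambda>\<sigma>. rate \<sigma> w) p"
    proof (rule Suc.IH[OF w])
      have "e * 1 \<le> e * (1 + h / 2)" using Suc.prems(2) par h by (intro mult_left_mono) auto
      then show "2 * a \<le> e' * (1 + h)" using grow Suc.prems(2) by linarith
      have "1 \<le> (e * (1 + h / 2)) * (1 + h / 2) ^ l" using Suc.prems(3) by (simp add: mult_ac)
      also have "\<dots> \<le> (e' * (1 + h)) * (1 + h / 2) ^ l"
        using grow h by (intro mult_right_mono) auto
      finally show "1 \<le> e' * (1 + h) * (1 + h / 2) ^ l" .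
    qed
  next
    show "a \<le> e'" using ea e' by linarith
    show "0 \<le> \<beta> * Q ^ l" using \<beta> Ql by simp
  qed
  \<comment> \<open>The summand 1 stands for the failure \<beta> of the sampling at the conjunction
    itself; the factor 2 in \<open>Q\<close> absorbs it.\<close>
  have qKQ: "real q * (K * Q ^ l) + 1 \<le> Q ^ Suc l"
  proof -
    have "1 * 1 \<le> real q * K * Q ^ l" using qK Ql by (intro mult_mono) auto
    then show ?thesis by (simp add: par(7) algebra_simps)
  qed
  show ?case
  proof (cases "\<exists>f ts. t = Gate f ts \<and> is_conj (length ts) f")
    case False
    have "\<exists>p. estimator (set (leaf_vars t)) (K * Q ^ l) e (K * (\<beta> * Q ^ l)) (\<lambda>\<sigma>. rate \<sigma> t) p"
      by (rule step[OF Suc.prems(1)]) (use False \<gamma> in auto)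
    then obtain p where p: "estimator (set (leaf_vars t)) (K * Q ^ l) e (K * (\<beta> * Q ^ l))
        (\<lambda>\<sigma>. rate \<sigma> t) p" ..
    have "K * Q ^ l \<le> Q * Q ^ l"
      using qK K Ql par(4,7) mult_right_mono[of 1 "2 * real q" K] by (intro mult_right_mono) auto
    then have "K * Q ^ l \<le> Q ^ Suc l" by simp
    moreover from mult_left_mono[OF this \<beta>] have "K * (\<beta> * Q ^ l) \<le> \<beta> * Q ^ Suc l"
      by (simp add: mult_ac)
    ultimately show ?thesis using estimator_mono[OF p] by blast
  next
    case True
    then obtain f ts where g: "t = Gate f ts" and conj: "is_conj (length ts) f" by blast
    have kb: "k_basic k X (Gate f ts)" using Suc.prems(1) g by simp
    have "\<exists>p. estimator (set (leaf_vars u)) (K * Q ^ l) (e - \<gamma>) (K * (\<beta> * Q ^ l)) (\<lambda>\<sigma>. rate \<sigma> u) p"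
      if u: "u \<in> set ts" for u
    proof (rule step[OF k_basic_child[OF kb u]])
      fix f' ts' assume "u = Gate f' ts'"
      moreover have "Gate f ts \<in> subformulas (Gate f ts)" by simp
      ultimately show "\<not> is_conj (length ts') f'"
        using kb u conj unfolding k_basic_def kx_basic_def by blast
    qed simp
    then obtain p where "\<And>u. u \<in> set ts \<Longrightarrow> estimator (set (leaf_vars u)) (K * Q ^ l) (e - \<gamma>)
        (K * (\<beta> * Q ^ l)) (\<lambda>\<sigma>. rate \<sigma> u) (p u)"
      by metis
    from estimator_conj[OF kb conj this par(4), of \<gamma>] \<gamma> \<beta> K Ql
    obtain p' where p': "estimator (set (leaf_vars t)) (real q * (K * Q ^ l)) (e - \<gamma> + \<gamma>)
        (real q * (K * (\<beta> * Q ^ l)) + \<beta>) (\<lambda>\<sigma>. rate \<sigma> t) p'"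
      by (auto simp: g par(6))
    have "real q * (K * (\<beta> * Q ^ l)) + \<beta> = \<beta> * (real q * (K * Q ^ l) + 1)"
      by (simp add: algebra_simps)
    also have "\<dots> \<le> \<beta> * Q ^ Suc l" by (rule mult_left_mono[OF qKQ \<beta>])
    finally have "estimator (set (leaf_vars t)) (Q ^ Suc l) e (\<beta> * Q ^ Suc l) (\<lambda>\<sigma>. rate \<sigma> t) p'"
      using qKQ by (intro estimator_mono[OF p']) auto
    then show ?thesis ..
  qed
qed

text \<open>With \<open>K = z\<close> and \<open>a = 1 / z\<close> the lower limit
  \<open>2 * a\<close> of the recursion is exactly the accuracy claimed. All other parameters are
  polynomials in \<open>z\<close> and \<open>D\<close>, or their inverses, so
  \<open>ln (Q ^ l)\<close> stays below \<open>z ^ 6 * D\<close>, the exponent of \<beta>.\<close>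

lemma estimator_exists:
  fixes z D :: nat and \<delta> :: real
  assumes t: "k_basic k X t" and z: "10 \<le> z" "k \<le> z"
    and D: "1 \<le> D" "ln (2 / \<delta>) \<le> real D" and \<delta>: "0 < \<delta>"
  shows "\<exists>p. estimator (set (leaf_vars t)) (exp (real D * real z ^ 6)) (2 / real z) \<delta> (\<lambda>\<sigma>. rate \<sigma> t) p"
proof -
  define a where "a = 1 / real z"
  define h where "h = a / (2 * real z)"
  \<comment> \<open>As \<open>\<gamma> = 1 / (8 * z ^ 3)\<close>, this makes the Hoeffding exponent
    \<open>2 * q * \<gamma> ^ 2\<close> equal to \<open>z ^ 6 * D\<close>.\<close>
  define q where "q = 32 * z ^ 12 * D"
  define \<gamma> where "\<gamma> = a * h / 4"
  define \<beta> where "\<beta> = 2 * exp (- 2 * real q * \<gamma>\<^sup>2)"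
  define Q where "Q = 2 * real q * real z"
  \<comment> \<open>As \<open>h = 1 / (2 * z ^ 2)\<close>, this gives
    \<open>l * (h / 2) = z / 2\<close>, so by Bernoulli's inequality \<open>(1 + h / 2) ^ l\<close>
    exceeds \<open>z / 2\<close>, the inverse of the accuracy.\<close>
  define l where "l = 2 * z ^ 3"
  have zD: "10 \<le> real z" "1 \<le> real D" using z D by auto
  have h: "h = 1 / (2 * real z ^ 2)" by (simp add: h_def a_def power2_eq_square)
  have q: "0 < q" using z D by (simp add: q_def)
  have \<beta>: "\<beta> = 2 * exp (- (real z ^ 6 * real D))"
    using zD by (simp add: \<beta>_def q_def \<gamma>_def h a_def power2_eq_square power_numeral_reduce field_simps)
  have Qpos: "0 < Q" using q zD by (simp add: Q_def)
  have "ln Q = ln 64 + 13 * ln (real z) + ln (real D)"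
  proof -
    have "Q = 64 * real z ^ 13 * real D"
      by (simp add: Q_def q_def power_numeral_reduce)
    then show ?thesis using zD by (simp add: ln_mult ln_realpow)
  qed
  also have "\<dots> \<le> 64 + 13 * real z + real D"
    using ln_le_minus_one[of "64 :: real"] ln_le_minus_one[of "real z"] ln_le_minus_one[of "real D"] zD
    by simp
  also have "\<dots> \<le> 64 * real D + 13 * real z * real D + real D"
    using zD(2) mult_left_mono[OF zD(2), of "13 * real z"] by linarith
  also have "\<dots> = (65 + 13 * real z) * real D" by (simp add: algebra_simps)
  finally have lnQ: "ln Q \<le> (65 + 13 * real z) * real D" .
  \<comment> \<open>The bound \<open>z \<ge> 10\<close> enters through \<open>65 \<le> 7 * z\<close>
    and \<open>40 * z ^ 4 + 1 \<le> 100 * z ^ 4\<close>. The summand 1 is the margin that leaves a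
    failure probability of \<open>2 * exp (- D) \<le> \<delta>\<close>.\<close>
  have poly: "2 * real z ^ 3 * (65 + 13 * real z) + 1 \<le> real z ^ 6"
  proof -
    have "65 + 13 * real z \<le> 20 * real z" using zD by simp
    then have "2 * real z ^ 3 * (65 + 13 * real z) \<le> 2 * real z ^ 3 * (20 * real z)"
      by (intro mult_left_mono) auto
    also have "\<dots> = 40 * real z ^ 4" by (simp add: power_numeral_reduce)
    finally have "2 * real z ^ 3 * (65 + 13 * real z) \<le> 40 * real z ^ 4" .
    moreover have "1 \<le> real z ^ 4" using zD by simp
    moreover have "10 ^ 2 * real z ^ 4 \<le> real z ^ 2 * real z ^ 4"
      using zD by (intro mult_right_mono power_mono) auto
    moreover have "real z ^ 2 * real z ^ 4 = real z ^ 6" by (simp flip: power_add)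
    ultimately show ?thesis by simp
  qed
  have "real l * ln Q \<le> real l * ((65 + 13 * real z) * real D)"
    using lnQ by (intro mult_left_mono) auto
  also have "\<dots> = (2 * real z ^ 3 * (65 + 13 * real z)) * real D" by (simp add: l_def)
  also have "\<dots> \<le> (real z ^ 6 - 1) * real D"
    using poly by (intro mult_right_mono) auto
  finally have lnQl: "real l * ln Q + real D \<le> real z ^ 6 * real D" by (simp add: algebra_simps)
  have Ql: "Q ^ l = exp (real l * ln Q)"
    using Qpos by (simp add: exp_of_nat_mult)
  have "\<exists>p. estimator (set (leaf_vars t)) (Q ^ l) (2 / real z) (\<beta> * Q ^ l) (\<lambda>\<sigma>. rate \<sigma> t) p"
  proof (rule estimator_recursion[where K = "real z" and a = a and h = h and q = q and \<gamma> = \<gamma>])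
    have "1 \<le> real z ^ 2" using zD by simp
    then show "h \<le> 1" unfolding h by (auto simp: divide_le_eq_1)
    have "1 \<le> 2 / real z * (1 + real l * (h / 2))"
    proof -
      have "real l * (h / 2) = real z / 2"
        using zD by (simp add: l_def h power2_eq_square power3_eq_cube)
      then show ?thesis using zD by (simp add: field_simps)
    qed
    also have "\<dots> \<le> 2 / real z * (1 + h / 2) ^ l"
    proof (rule mult_left_mono)
      have "0 \<le> h" by (simp add: h)
      then show "1 + real l * (h / 2) \<le> (1 + h / 2) ^ l"
        by (intro Bernoulli_inequality) auto
    qed simp
    finally show "1 \<le> 2 / real z * (1 + h / 2) ^ l" .
  qed (use t zD z q in \<open>auto simp: a_def h_def \<gamma>_def \<beta>_def Q_def\<close>)
  then obtain p where p: "estimator (set (leaf_vars t)) (Q ^ l) (2 / real z) (\<beta> * Q ^ l)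
      (\<lambda>\<sigma>. rate \<sigma> t) p" ..
  have "estimator (set (leaf_vars t)) (exp (real D * real z ^ 6)) (2 / real z) \<delta> (\<lambda>\<sigma>. rate \<sigma> t) p"
  proof (rule estimator_mono[OF p])
    show "Q ^ l \<le> exp (real D * real z ^ 6)"
      using lnQl zD unfolding Ql by (simp add: mult.commute)
    have "\<beta> * Q ^ l = 2 * exp (real l * ln Q - real z ^ 6 * real D)"
      unfolding \<beta> Ql by (simp add: exp_diff exp_minus divide_inverse)
    also have "\<dots> \<le> 2 * exp (- ln (2 / \<delta>))"
      using lnQl D(2) by simp
    also have "\<dots> = \<delta>" using \<delta> by (simp add: exp_minus)
    finally show "\<beta> * Q ^ l \<le> \<delta>" .
  qed auto
  then show ?thesis ..
qed


section \<open>Distance to the satisfying assignments\<close>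

text \<open>Flipping variables outside the formula never helps, so an optimal assignment may agree
  with \<sigma> there. The distance to the satisfying assignments is thus the rate, scaled by the
  fraction \<open>c\<close> of variables that label leaves.\<close>

lemma rate_scaled_distance:
  assumes kb: "k_basic k X \<Phi>" and \<sigma>: "\<sigma> \<in> assignments X"
  defines "c \<equiv> real (length (leaf_vars \<Phi>)) / real (card X)"
  shows "\<exists>\<tau>\<in>SAT X \<Phi>. distance X \<sigma> \<tau> = rate \<sigma> \<Phi> * c"
    and "\<tau> \<in> SAT X \<Phi> \<Longrightarrow> rate \<sigma> \<Phi> * c \<le> distance X \<sigma> \<tau>"
    and "0 \<le> c" "c \<le> 1"
proof -
  define V where "V = set (leaf_vars \<Phi>)"
  have X: "finite X" "V \<subseteq> X"
    using kb by (auto simp: V_def k_basic_def kx_basic_def read_once_def)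
  have scale: "rate \<sigma> \<Phi> * c = real (cost \<sigma> \<Phi>) / real (card X)"
    by (simp add: c_def cost_eq_rate[OF kb])
  obtain \<tau>\<^sub>0 where "value_of \<tau>\<^sub>0 \<Phi>" using k_basic_satisfiable[OF kb] by blast
  then obtain \<rho> where \<rho>: "value_of \<rho> \<Phi>" "flips \<sigma> \<rho> \<Phi> = cost \<sigma> \<Phi>" by (rule cost_attained)
  define \<rho>' where "\<rho>' = (\<lambda>x. if x \<in> V then \<rho> x else \<sigma> x)"
  have "value_of \<rho>' \<Phi>"
    using \<rho>(1) value_of_cong[of \<Phi> \<rho>' \<rho>] by (simp add: \<rho>'_def V_def)
  moreover have "\<rho>' \<in> assignments X"
    using \<sigma> X(2) by (auto simp: assignments_def \<rho>'_def PiE_def extensional_def)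
  moreover have "{x \<in> X. \<sigma> x \<noteq> \<rho>' x} = {x \<in> set (leaf_vars \<Phi>). \<sigma> x \<noteq> \<rho> x}"
    using X(2) by (auto simp: \<rho>'_def V_def)
  ultimately show "\<exists>\<tau>\<in>SAT X \<Phi>. distance X \<sigma> \<tau> = rate \<sigma> \<Phi> * c"
    using \<rho>(2) by (intro bexI[of _ \<rho>']) (auto simp: SAT_def distance_def scale flips_def)
  show "rate \<sigma> \<Phi> * c \<le> distance X \<sigma> \<tau>" if "\<tau> \<in> SAT X \<Phi>"
  proof -
    have "cost \<sigma> \<Phi> \<le> flips \<sigma> \<tau> \<Phi>" using that by (intro cost_le_flips) (simp add: SAT_def)
    also have "\<dots> \<le> card {x \<in> X. \<sigma> x \<noteq> \<tau> x}"
      unfolding flips_def using X by (intro card_mono) (auto simp: V_def)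
    finally show ?thesis by (simp add: scale distance_def divide_right_mono)
  qed
  have "length (leaf_vars \<Phi>) = card V"
    unfolding V_def by (rule distinct_card[OF k_basic_distinct[OF kb], symmetric])
  also have "\<dots> \<le> card X" by (rule card_mono[OF X])
  finally show "c \<le> 1" by (auto simp: c_def divide_le_eq_1)
  show "0 \<le> c" by (simp add: c_def)
qed

lemma distance_estimator:
  fixes \<epsilon> \<delta> :: real and z :: nat
  assumes kb: "k_basic k X \<Phi>" and \<epsilon>: "0 < \<epsilon>" and \<delta>: "0 < \<delta>"
    and z: "10 \<le> z" "k \<le> z" "4 / \<epsilon> \<le> real z" and D: "1 \<le> D" "ln (2 / \<delta>) \<le> real D"
  shows "\<exists>p. \<forall>\<sigma> \<in> assignments X.
    (\<forall>T \<in> set_pmf p. set (queries T \<sigma>) \<subseteq> X \<and> run T \<sigma> \<in> {0..1} \<and>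
       real (length (queries T \<sigma>)) \<le> exp (real D * real z ^ 6)) \<and>
    measure_pmf.prob p {T. close_to X (run T \<sigma> + \<epsilon>) \<sigma> (SAT X \<Phi>) \<and>
      far_from X (run T \<sigma> - \<epsilon>) \<sigma> (SAT X \<Phi>)} \<ge> 1 - \<delta> \<and>
    (\<sigma> \<in> SAT X \<Phi> \<longrightarrow> measure_pmf.prob p {T. run T \<sigma> = 0} = 1)"
proof -
  define c where "c = real (length (leaf_vars \<Phi>)) / real (card X)"
  define scale where "scale = (\<lambda>T :: ('a, real) dtree. bind_dtree T (\<lambda>r. Output (r * c)))"
  obtain p where p: "estimator (set (leaf_vars \<Phi>)) (exp (real D * real z ^ 6)) (2 / real z) \<delta>
      (\<lambda>\<sigma>. rate \<sigma> \<Phi>) p"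
    using estimator_exists[OF kb z(1,2) D \<delta>] ..
  \<comment> \<open>Half of \<epsilon> is aimed at because \<open>far_from\<close> asks for a strict
    inequality.\<close>
  have acc: "2 / real z \<le> \<epsilon> / 2" using z \<epsilon> by (simp add: field_simps)
  have leafX: "set (leaf_vars \<Phi>) \<subseteq> X"
    using kb by (simp add: k_basic_def kx_basic_def read_once_def)
  show ?thesis
  proof (intro exI[of _ "map_pmf scale p"] ballI conjI impI)
    fix \<sigma> assume \<sigma>: "\<sigma> \<in> assignments X"
    note dist = rate_scaled_distance[OF kb \<sigma>, folded c_def]
    have est: "set (queries T \<sigma>) \<subseteq> set (leaf_vars \<Phi>)"
        "real (length (queries T \<sigma>)) \<le> exp (real D * real z ^ 6)"
        "run T \<sigma> \<in> {0..1}" "rate \<sigma> \<Phi> = 0 \<Longrightarrow> run T \<sigma> = 0" if "T \<in> set_pmf p" for T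
      using p that unfolding estimator_def by blast+
    {
      fix T assume "T \<in> set_pmf (map_pmf scale p)"
      then obtain T' where T': "T' \<in> set_pmf p" "T = scale T'" by auto
      show "set (queries T \<sigma>) \<subseteq> X" "real (length (queries T \<sigma>)) \<le> exp (real D * real z ^ 6)"
        using est[OF T'(1)] leafX T'(2) by (auto simp: scale_def)
      show "run T \<sigma> \<in> {0..1}"
        using est(3)[OF T'(1)] dist(3,4) mult_mono[of "run T' \<sigma>" 1 c 1] T'(2) by (simp add: scale_def)
    }
    have good: "close_to X (run (scale T) \<sigma> + \<epsilon>) \<sigma> (SAT X \<Phi>) \<and>
        far_from X (run (scale T) \<sigma> - \<epsilon>) \<sigma> (SAT X \<Phi>)"
      if T: "\<not> 2 / real z < \<bar>run T \<sigma> - rate \<sigma> \<Phi>\<bar>" for T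
    proof -
      have "\<bar>run T \<sigma> * c - rate \<sigma> \<Phi> * c\<bar> = \<bar>run T \<sigma> - rate \<sigma> \<Phi>\<bar> * c"
        using dist(3) by (simp add: abs_mult flip: left_diff_distrib)
      also have "\<dots> \<le> (\<epsilon> / 2) * 1"
        using dist(3,4) T acc \<epsilon> by (intro mult_mono) auto
      finally have err: "\<bar>run T \<sigma> * c - rate \<sigma> \<Phi> * c\<bar> < \<epsilon>" using \<epsilon> by simp
      have "close_to X (run T \<sigma> * c + \<epsilon>) \<sigma> (SAT X \<Phi>)"
        using dist(1) err unfolding close_to_def far_from_def by fastforce
      moreover have "far_from X (run T \<sigma> * c - \<epsilon>) \<sigma> (SAT X \<Phi>)"
        using dist(2) err unfolding far_from_def by fastforce
      ultimately show ?thesis by (simp add: scale_def)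
    qed
    have "1 - \<delta> \<le> 1 - measure_pmf.prob p {T. 2 / real z < \<bar>run T \<sigma> - rate \<sigma> \<Phi>\<bar>}"
      using p unfolding estimator_def by (simp add: diff_left_mono)
    also have "\<dots> = measure_pmf.prob p (UNIV - {T. 2 / real z < \<bar>run T \<sigma> - rate \<sigma> \<Phi>\<bar>})"
      by (subst measure_pmf.prob_compl[symmetric]) auto
    also have "\<dots> \<le> measure_pmf.prob p (scale -` {T. close_to X (run T \<sigma> + \<epsilon>) \<sigma> (SAT X \<Phi>) \<and>
        far_from X (run T \<sigma> - \<epsilon>) \<sigma> (SAT X \<Phi>)})"
      by (rule measure_pmf.finite_measure_mono) (use good in auto)
    finally show "measure_pmf.prob (map_pmf scale p) {T. close_to X (run T \<sigma> + \<epsilon>) \<sigma> (SAT X \<Phi>) \<and>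
        far_from X (run T \<sigma> - \<epsilon>) \<sigma> (SAT X \<Phi>)} \<ge> 1 - \<delta>"
      by simp
    show "measure_pmf.prob (map_pmf scale p) {T. run T \<sigma> = 0} = 1" if "\<sigma> \<in> SAT X \<Phi>"
    proof -
      have "rate \<sigma> \<Phi> = 0" using that rate_eq_0_iff[OF kb] by (simp add: SAT_def)
      then show ?thesis
        using est(4) by (auto simp: measure_pmf.prob_eq_1 AE_measure_pmf_iff scale_def)
    qed
  qed
qed

theorem theorem4p1:
  fixes k :: nat
  assumes "k \<ge> 2"
  shows "\<exists>A :: 'v set \<Rightarrow> 'v formula \<Rightarrow> real \<Rightarrow> real \<Rightarrow> ('v, real) dtree pmf.
    (\<forall>X \<Phi> \<epsilon> \<delta> \<sigma>. k_basic k X \<Phi> \<and> \<epsilon> > 0 \<and> \<delta> > 0 \<and> \<sigma> \<in> assignments X \<longrightarrow>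
       (\<forall>T \<in> set_pmf (A X \<Phi> \<epsilon> \<delta>). set (queries T \<sigma>) \<subseteq> X \<and> run T \<sigma> \<in> {0..1}) \<and>
       measure_pmf.prob (A X \<Phi> \<epsilon> \<delta>)
         {T. close_to X (run T \<sigma> + \<epsilon>) \<sigma> (SAT X \<Phi>) \<and>
             far_from X (run T \<sigma> - \<epsilon>) \<sigma> (SAT X \<Phi>)} \<ge> 1 - \<delta> \<and>
       (\<sigma> \<in> SAT X \<Phi> \<longrightarrow> measure_pmf.prob (A X \<Phi> \<epsilon> \<delta>) {T. run T \<sigma> = 0} = 1)) \<and>
    (\<forall>\<delta>>0. \<exists>(p :: real poly) (C :: real).
       \<forall>X \<Phi> \<epsilon> \<sigma>. k_basic k X \<Phi> \<and> \<epsilon> > 0 \<and> \<sigma> \<in> assignments X \<longrightarrow>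
         (\<forall>T \<in> set_pmf (A X \<Phi> \<epsilon> \<delta>).
            real (length (queries T \<sigma>)) \<le> C * exp (poly p (1 / \<epsilon>))))"
proof -
  define D where "D = (\<lambda>\<delta> :: real. nat \<lceil>max 1 (ln (2 / \<delta>))\<rceil>)"
  \<comment> \<open>The summands provide \<open>4 / \<epsilon> \<le> z\<close>,
    \<open>k \<le> z\<close> and \<open>10 \<le> z\<close> at once, and keep \<open>z\<close> linear
    in \<open>1 / \<epsilon>\<close>.\<close>
  define z where "z = (\<lambda>\<epsilon> :: real. nat \<lceil>4 / \<epsilon>\<rceil> + k + 10)"
  \<comment> \<open>The quantifier over \<sigma> is inside, so the distribution picked by
    \<open>SOME\<close> cannot depend on the queried assignment.\<close>
  define good where "good = (\<lambda>X \<Phi> \<epsilon> \<delta> (p :: ('v, real) dtree pmf). \<forall>\<sigma> \<in> assignments X.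
    (\<forall>T \<in> set_pmf p. set (queries T \<sigma>) \<subseteq> X \<and> run T \<sigma> \<in> {0..1} \<and>
       real (length (queries T \<sigma>)) \<le> exp (real (D \<delta>) * real (z \<epsilon>) ^ 6)) \<and>
    measure_pmf.prob p {T. close_to X (run T \<sigma> + \<epsilon>) \<sigma> (SAT X \<Phi>) \<and>
      far_from X (run T \<sigma> - \<epsilon>) \<sigma> (SAT X \<Phi>)} \<ge> 1 - \<delta> \<and>
    (\<sigma> \<in> SAT X \<Phi> \<longrightarrow> measure_pmf.prob p {T. run T \<sigma> = 0} = 1))"
  define A where "A = (\<lambda>X \<Phi> \<epsilon> \<delta>. SOME p. good X \<Phi> \<epsilon> \<delta> p)"
  have A: "good X \<Phi> \<epsilon> \<delta> (A X \<Phi> \<epsilon> \<delta>)" if "k_basic k X \<Phi>" "\<epsilon> > 0" "\<delta> > 0" for X \<Phi> and \<epsilon> \<delta> :: real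
    unfolding A_def
  proof (rule someI_ex)
    have "4 / \<epsilon> \<le> real (z \<epsilon>)"
      unfolding z_def using real_nat_ceiling_ge[of "4 / \<epsilon>"] by simp
    moreover have "max 1 (ln (2 / \<delta>)) \<le> real (D \<delta>)"
      unfolding D_def by (rule real_nat_ceiling_ge)
    ultimately show "\<exists>p. good X \<Phi> \<epsilon> \<delta> p"
      unfolding good_def using that by (intro distance_estimator) (auto simp: z_def)
  qed
  show ?thesis
  proof (intro exI[of _ A] conjI allI impI)
    fix X :: "'v set" and \<Phi> and \<epsilon> \<delta> :: real and \<sigma>
    assume "k_basic k X \<Phi> \<and> 0 < \<epsilon> \<and> 0 < \<delta> \<and> \<sigma> \<in> assignments X"
    then have g: "good X \<Phi> \<epsilon> \<delta> (A X \<Phi> \<epsilon> \<delta>)" and \<sigma>: "\<sigma> \<in> assignments X" using A by auto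
    show "\<forall>T \<in> set_pmf (A X \<Phi> \<epsilon> \<delta>). set (queries T \<sigma>) \<subseteq> X \<and> run T \<sigma> \<in> {0..1}"
      "measure_pmf.prob (A X \<Phi> \<epsilon> \<delta>)
         {T. close_to X (run T \<sigma> + \<epsilon>) \<sigma> (SAT X \<Phi>) \<and>
             far_from X (run T \<sigma> - \<epsilon>) \<sigma> (SAT X \<Phi>)} \<ge> 1 - \<delta>"
      using bspec[OF g[unfolded good_def] \<sigma>] by blast+
    show "measure_pmf.prob (A X \<Phi> \<epsilon> \<delta>) {T. run T \<sigma> = 0} = 1" if "\<sigma> \<in> SAT X \<Phi>"
      using bspec[OF g[unfolded good_def] \<sigma>] that by blast
  next
    fix \<delta> :: real assume \<delta>: "\<delta> > 0"
    \<comment> \<open>The constant 11 is the 10 from \<open>z\<close> and 1 for rounding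
      \<open>4 / \<epsilon>\<close> up.\<close>
    define p where "p = smult (real (D \<delta>)) ([:real k + 11, 4:] ^ 6)"
    have "real (length (queries T \<sigma>)) \<le> 1 * exp (poly p (1 / \<epsilon>))"
      if kb: "k_basic k X \<Phi>" and \<epsilon>: "\<epsilon> > 0" and \<sigma>: "\<sigma> \<in> assignments X"
        and T: "T \<in> set_pmf (A X \<Phi> \<epsilon> \<delta>)" for X :: "'v set" and \<Phi> and \<epsilon> :: real and \<sigma> T
    proof -
      have "real (length (queries T \<sigma>)) \<le> exp (real (D \<delta>) * real (z \<epsilon>) ^ 6)"
        using bspec[OF A[OF kb \<epsilon> \<delta>, unfolded good_def] \<sigma>] T by blast
      also have "real (z \<epsilon>) \<le> real k + 11 + 4 * (1 / \<epsilon>)"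
        using \<epsilon> by (simp add: z_def) linarith
      then have "real (D \<delta>) * real (z \<epsilon>) ^ 6 \<le> real (D \<delta>) * (real k + 11 + 4 * (1 / \<epsilon>)) ^ 6"
        by (intro mult_left_mono power_mono) auto
      also have "\<dots> = poly p (1 / \<epsilon>)" by (simp add: p_def poly_power algebra_simps)
      finally show ?thesis by simp
    qed
    then show "\<exists>(p :: real poly) (C :: real).
       \<forall>X \<Phi> \<epsilon> \<sigma>. k_basic k X \<Phi> \<and> \<epsilon> > 0 \<and> \<sigma> \<in> assignments X \<longrightarrow>
         (\<forall>T \<in> set_pmf (A X \<Phi> \<epsilon> \<delta>). real (length (queries T \<sigma>)) \<le> C * exp (poly p (1 / \<epsilon>)))"
      by blast
  qed
qed

end
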